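(* Let $\mathcal{M}_0$ be a dependent structure in a language $\mathcal{L}_0$, and let $\mathcal{M}$ be an arbitrary expansion of $\mathcal{M}_0$ in some language $\mathcal{L}\supseteq\mathcal{L}_0$. Let $\varphi(x_1,\ldots,x_d)$ be an $\mathcal{L}_0$-formula. Let $y_1,y_2,y_3$ be finite tuples of variables. For each $i\in\{1,\ldots,d\}$, fix some $s_i<t_i\in\{1,2,3\}$ and let $f_i:M_{y_{s_i}}\times M_{y_{t_i}}\to M_{x_i}$ be an $\mathcal{L}$-definable binary function. Then the $\mathcal{L}$-formula $$\psi(y_1;y_2,y_3):=\varphi\left(f_1(y_{s_1},y_{t_1}),\ldots,f_d(y_{s_d},y_{t_d})\right)$$ is $2$-dependent (with respect to $\mathrm{Th}_{\mathcal{L}}(\mathcal{M})$).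
   Context: All variables $x_i,y_j$ are allowed to be tuples of arbitrary finite length; for a tuple of variables $x$, $M_x$ denotes the corresponding product of sorts of $\mathcal{M}$. A partitioned formula $\varphi(x;y_1,\ldots,y_n)$ has the $n$-independence property with respect to a theory $T$ if in some model of $T$ there is a sequence of tuples $(a_{1,i},\ldots,a_{n,i})_{i\in\omega}$ such that for every $s\subseteq\omega^n$ there is a tuple $b_s$ with $\models\varphi(b_s;a_{1,i_1},\ldots,a_{n,i_n})\Leftrightarrow(i_1,\ldots,i_n)\in s$; otherwise it is $n$-dependent. A theory is $n$-dependent if every formula is $n$-dependent with respect to it; a structure is $n$-dependent if its theory is; "dependent" means $1$-dependent (NIP). *)

theory Defs
  imports Main
begin

section \<open>Many-sorted first-order logic\<close>

text \<open>A variable carries its sort; every sort has countably many variables.\<close>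

type_synonym 's var = "nat \<times> 's"

abbreviation var_sort :: "'s var \<Rightarrow> 's" where
  "var_sort \<equiv> snd"

record ('f, 'r, 's) language =
  sorts :: "'s set"
  fun_syms :: "'f set"
  rel_syms :: "'r set"
  fun_dom :: "'f \<Rightarrow> 's list"
  fun_cod :: "'f \<Rightarrow> 's"
  rel_dom :: "'r \<Rightarrow> 's list"

definition is_language :: "('f, 'r, 's) language \<Rightarrow> bool" where
  "is_language L \<longleftrightarrow>
     (\<forall>g\<in>fun_syms L. set (fun_dom L g) \<subseteq> sorts L \<and> fun_cod L g \<in> sorts L) \<and>
     (\<forall>r\<in>rel_syms L. set (rel_dom L r) \<subseteq> sorts L)"

definition vars :: "('f, 'r, 's) language \<Rightarrow> 's var set" where
  "vars L = {v. var_sort v \<in> sorts L}"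

datatype ('f, 's) tm = Var "'s var" | Fn 'f "('f, 's) tm list"

datatype ('f, 'r, 's) fm =
    Eq "('f, 's) tm" "('f, 's) tm"
  | Rel 'r "('f, 's) tm list"
  | Neg "('f, 'r, 's) fm"
  | And "('f, 'r, 's) fm" "('f, 'r, 's) fm"
  | Ex "'s var" "('f, 'r, 's) fm"

primrec fv_tm :: "('f, 's) tm \<Rightarrow> 's var set" where
  "fv_tm (Var v) = {v}"
| "fv_tm (Fn g ts) = \<Union> (set (map fv_tm ts))"

primrec fv :: "('f, 'r, 's) fm \<Rightarrow> 's var set" where
  "fv (Eq t u) = fv_tm t \<union> fv_tm u"
| "fv (Rel r ts) = \<Union> (set (map fv_tm ts))"
| "fv (Neg p) = fv p"
| "fv (And p q) = fv p \<union> fv q"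
| "fv (Ex v p) = fv p - {v}"

primrec tm_sort :: "('f, 'r, 's) language \<Rightarrow> ('f, 's) tm \<Rightarrow> 's" where
  "tm_sort L (Var v) = var_sort v"
| "tm_sort L (Fn g ts) = fun_cod L g"

primrec is_term :: "('f, 'r, 's) language \<Rightarrow> ('f, 's) tm \<Rightarrow> bool" where
  "is_term L (Var v) \<longleftrightarrow> v \<in> vars L"
| "is_term L (Fn g ts) \<longleftrightarrow>
     g \<in> fun_syms L \<and> map (tm_sort L) ts = fun_dom L g \<and> list_all id (map (is_term L) ts)"

primrec is_formula :: "('f, 'r, 's) language \<Rightarrow> ('f, 'r, 's) fm \<Rightarrow> bool" where
  "is_formula L (Eq t u) \<longleftrightarrow> is_term L t \<and> is_term L u \<and> tm_sort L t = tm_sort L u"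
| "is_formula L (Rel r ts) \<longleftrightarrow>
     r \<in> rel_syms L \<and> map (tm_sort L) ts = rel_dom L r \<and> list_all (is_term L) ts"
| "is_formula L (Neg p) \<longleftrightarrow> is_formula L p"
| "is_formula L (And p q) \<longleftrightarrow> is_formula L p \<and> is_formula L q"
| "is_formula L (Ex v p) \<longleftrightarrow> v \<in> vars L \<and> is_formula L p"

text \<open>
  All sorts of a structure are sets of elements of one type \<open>'a\<close>; they need not be disjoint.
  Values outside the language and outside the carriers are irrelevant.
\<close>

record ('f, 'r, 's, 'a) struct =
  carrier :: "'s \<Rightarrow> 'a set"
  fun_int :: "'f \<Rightarrow> 'a list \<Rightarrow> 'a"
  rel_int :: "'r \<Rightarrow> 'a list \<Rightarrow> bool"

definition sort_tuples :: "('f, 'r, 's, 'a) struct \<Rightarrow> 's list \<Rightarrow> 'a list set" where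
  "sort_tuples M ss = {as. list_all2 (\<lambda>a s. a \<in> carrier M s) as ss}"

text \<open>The product \<open>M\<^sub>x\<close> of sorts belonging to a tuple of variables \<open>x\<close>.\<close>

definition tuples :: "('f, 'r, 's, 'a) struct \<Rightarrow> 's var list \<Rightarrow> 'a list set" where
  "tuples M vs = sort_tuples M (map var_sort vs)"

definition is_struct :: "('f, 'r, 's) language \<Rightarrow> ('f, 'r, 's, 'a) struct \<Rightarrow> bool" where
  "is_struct L M \<longleftrightarrow>
     (\<forall>s\<in>sorts L. carrier M s \<noteq> {}) \<and>
     (\<forall>g\<in>fun_syms L. \<forall>as\<in>sort_tuples M (fun_dom L g).
        fun_int M g as \<in> carrier M (fun_cod L g))"

primrec eval_tm :: "('f, 'r, 's, 'a) struct \<Rightarrow> ('s var \<Rightarrow> 'a) \<Rightarrow> ('f, 's) tm \<Rightarrow> 'a" where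
  "eval_tm M e (Var v) = e v"
| "eval_tm M e (Fn g ts) = fun_int M g (map (eval_tm M e) ts)"

primrec sat :: "('f, 'r, 's, 'a) struct \<Rightarrow> ('s var \<Rightarrow> 'a) \<Rightarrow> ('f, 'r, 's) fm \<Rightarrow> bool" where
  "sat M e (Eq t u) \<longleftrightarrow> eval_tm M e t = eval_tm M e u"
| "sat M e (Rel r ts) \<longleftrightarrow> rel_int M r (map (eval_tm M e) ts)"
| "sat M e (Neg p) \<longleftrightarrow> \<not> sat M e p"
| "sat M e (And p q) \<longleftrightarrow> sat M e p \<and> sat M e q"
| "sat M e (Ex v p) \<longleftrightarrow> (\<exists>a\<in>carrier M (var_sort v). sat M (e(v := a)) p)"

text \<open>
  \<open>M \<Turnstile> p(as)\<close>, where \<open>p = p(vs)\<close>. Used only for distinct \<open>vs\<close> containing all free variables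
  of \<open>p\<close> and for \<open>as\<close> of the same length, in which case the choice of \<open>e\<close> does not matter.
\<close>

definition sat_at ::
    "('f, 'r, 's, 'a) struct \<Rightarrow> ('f, 'r, 's) fm \<Rightarrow> 's var list \<Rightarrow> 'a list \<Rightarrow> bool" where
  "sat_at M p vs as \<longleftrightarrow> (\<exists>e. map e vs = as \<and> sat M e p)"

definition Th :: "('f, 'r, 's) language \<Rightarrow> ('f, 'r, 's, 'a) struct \<Rightarrow> ('f, 'r, 's) fm set" where
  "Th L M = {p. is_formula L p \<and> fv p = {} \<and> (\<forall>e. sat M e p)}"

definition is_model ::
    "('f, 'r, 's) language \<Rightarrow> ('f, 'r, 's) fm set \<Rightarrow> ('f, 'r, 's, 'a) struct \<Rightarrow> bool" where
  "is_model L T N \<longleftrightarrow> is_struct L N \<and> (\<forall>p\<in>T. \<forall>e. sat N e p)"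

definition sublanguage :: "('f, 'r, 's) language \<Rightarrow> ('f, 'r, 's) language \<Rightarrow> bool" where
  "sublanguage L0 L \<longleftrightarrow>
     sorts L0 \<subseteq> sorts L \<and> fun_syms L0 \<subseteq> fun_syms L \<and> rel_syms L0 \<subseteq> rel_syms L \<and>
     (\<forall>g\<in>fun_syms L0. fun_dom L0 g = fun_dom L g \<and> fun_cod L0 g = fun_cod L g) \<and>
     (\<forall>r\<in>rel_syms L0. rel_dom L0 r = rel_dom L r)"

text \<open>The language of an expansion may also have new sorts.\<close>

definition expansion ::
    "('f, 'r, 's) language \<Rightarrow> ('f, 'r, 's, 'a) struct \<Rightarrow>
     ('f, 'r, 's) language \<Rightarrow> ('f, 'r, 's, 'a) struct \<Rightarrow> bool" where
  "expansion L0 M0 L M \<longleftrightarrow>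
     sublanguage L0 L \<and> is_struct L0 M0 \<and> is_struct L M \<and>
     (\<forall>s\<in>sorts L0. carrier M s = carrier M0 s) \<and>
     (\<forall>g\<in>fun_syms L0. \<forall>as\<in>sort_tuples M0 (fun_dom L0 g). fun_int M g as = fun_int M0 g as) \<and>
     (\<forall>r\<in>rel_syms L0. \<forall>as\<in>sort_tuples M0 (rel_dom L0 r). rel_int M r as = rel_int M0 r as)"

text \<open>
  Definability is without parameters; parameters can be named by constants of \<open>L\<close>.
\<close>

definition defines_rel ::
    "('f, 'r, 's) language \<Rightarrow> ('f, 'r, 's, 'a) struct \<Rightarrow> ('f, 'r, 's) fm \<Rightarrow> 's var list \<Rightarrow>
     'a list set \<Rightarrow> bool" where
  "defines_rel L M p vs R \<longleftrightarrow>
     is_formula L p \<and> fv p \<subseteq> set vs \<and> (\<forall>as\<in>tuples M vs. sat_at M p vs as \<longleftrightarrow> as \<in> R)"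

text \<open>\<open>f : M\<^sub>u \<times> M\<^sub>v \<rightarrow> M\<^sub>w\<close> has an \<open>L\<close>-definable graph; \<open>u\<close>, \<open>v\<close>, \<open>w\<close> are disjoint tuples.\<close>

definition definable_fun2 ::
    "('f, 'r, 's) language \<Rightarrow> ('f, 'r, 's, 'a) struct \<Rightarrow> 's var list \<Rightarrow> 's var list \<Rightarrow>
     's var list \<Rightarrow> ('a list \<Rightarrow> 'a list \<Rightarrow> 'a list) \<Rightarrow> bool" where
  "definable_fun2 L M u v w f \<longleftrightarrow>
     (\<forall>a\<in>tuples M u. \<forall>b\<in>tuples M v. f a b \<in> tuples M w) \<and>
     (\<exists>p. defines_rel L M p (u @ v @ w) {a @ b @ f a b | a b. a \<in> tuples M u \<and> b \<in> tuples M v})"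


section \<open>The n-independence property\<close>

text \<open>The partitioned formula \<open>p(x; y\<^sub>1, \<dots>, y\<^sub>n)\<close>, where \<open>ys = [y\<^sub>1, \<dots>, y\<^sub>n]\<close>.\<close>

definition partitioned_formula ::
    "('f, 'r, 's) language \<Rightarrow> ('f, 'r, 's) fm \<Rightarrow> 's var list \<Rightarrow> 's var list list \<Rightarrow> bool" where
  "partitioned_formula L p x ys \<longleftrightarrow>
     is_formula L p \<and> distinct (x @ concat ys) \<and> set (x @ concat ys) \<subseteq> vars L \<and>
     fv p \<subseteq> set (x @ concat ys)"

text \<open>
  Elements of \<open>\<omega>\<^sup>n\<close> are lists \<open>I\<close> of length \<open>n = length ys\<close>, and \<open>a j i\<close> is the tuple
  \<open>a\<^bsub>j+1,i\<^esub>\<close>.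
\<close>

definition shatters_in ::
    "('f, 'r, 's, 'a) struct \<Rightarrow> ('f, 'r, 's) fm \<Rightarrow> 's var list \<Rightarrow> 's var list list \<Rightarrow> bool" where
  "shatters_in N p x ys \<longleftrightarrow>
     (\<exists>a :: nat \<Rightarrow> nat \<Rightarrow> 'a list.
        (\<forall>j<length ys. \<forall>i. a j i \<in> tuples N (ys ! j)) \<and>
        (\<forall>S \<subseteq> {I :: nat list. length I = length ys}.
           \<exists>b\<in>tuples N x. \<forall>I. length I = length ys \<longrightarrow>
             (sat_at N p (x @ concat ys) (b @ concat (map (\<lambda>j. a j (I ! j)) [0..<length ys]))
                \<longleftrightarrow> I \<in> S)))"

text \<open>
  HOL cannot quantify over all types inside a formula, so the type \<open>'u\<close> of the elements of the
  models of \<open>T\<close> is an explicit parameter (only the type of the argument \<open>U\<close> matters).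
  A theorem concluding dependence for a free type variable \<open>'u\<close> covers models of any size.
  For a structure on a type \<open>'a\<close>, assuming dependence only for models on
  \<open>nat \<Rightarrow> 'a\<close> loses nothing: by compactness, a formula with the independence property
  in some model of the theory of \<open>M\<close> has it in an ultrapower of \<open>M\<close> over a nonprincipal
  ultrafilter on \<open>nat\<close>, and representatives of the elements of that ultrapower
  lie in \<open>nat \<Rightarrow> 'a\<close>.
\<close>

definition has_independence_property ::
    "'u itself \<Rightarrow> ('f, 'r, 's) language \<Rightarrow> ('f, 'r, 's) fm set \<Rightarrow>
     ('f, 'r, 's) fm \<Rightarrow> 's var list \<Rightarrow> 's var list list \<Rightarrow> bool" where
  "has_independence_property U L T p x ys \<longleftrightarrow>
     (\<exists>N :: ('f, 'r, 's, 'u) struct. is_model L T N \<and> shatters_in N p x ys)"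

definition n_dependent_formula ::
    "'u itself \<Rightarrow> nat \<Rightarrow> ('f, 'r, 's) language \<Rightarrow> ('f, 'r, 's) fm set \<Rightarrow>
     ('f, 'r, 's) fm \<Rightarrow> 's var list \<Rightarrow> 's var list list \<Rightarrow> bool" where
  "n_dependent_formula U n L T p x ys \<longleftrightarrow>
     partitioned_formula L p x ys \<and> length ys = n \<and> \<not> has_independence_property U L T p x ys"

definition n_dependent_theory ::
    "'u itself \<Rightarrow> nat \<Rightarrow> ('f, 'r, 's) language \<Rightarrow> ('f, 'r, 's) fm set \<Rightarrow> bool" where
  "n_dependent_theory U n L T \<longleftrightarrow>
     (\<forall>p x ys. partitioned_formula L p x ys \<and> length ys = n \<longrightarrow> n_dependent_formula U n L T p x ys)"

definition n_dependent_structure ::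
    "'u itself \<Rightarrow> nat \<Rightarrow> ('f, 'r, 's) language \<Rightarrow> ('f, 'r, 's, 'a) struct \<Rightarrow> bool" where
  "n_dependent_structure U n L M \<longleftrightarrow> n_dependent_theory U n L (Th L M)"

abbreviation dependent_structure ::
    "'u itself \<Rightarrow> ('f, 'r, 's) language \<Rightarrow> ('f, 'r, 's, 'a) struct \<Rightarrow> bool" where
  "dependent_structure U L M \<equiv> n_dependent_structure U 1 L M"


section \<open>Composing a formula with binary functions\<close>

text \<open>
  The subset of \<open>M\<^bsub>y\<^sub>1\<^esub> \<times> M\<^bsub>y\<^sub>2\<^esub> \<times> M\<^bsub>y\<^sub>3\<^esub>\<close> given by
  \<open>p(f\<^sub>1(y\<^bsub>s\<^sub>1\<^esub>, y\<^bsub>t\<^sub>1\<^esub>), \<dots>, f\<^sub>d(y\<^bsub>s\<^sub>d\<^esub>, y\<^bsub>t\<^sub>d\<^esub>))\<close>.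
  Since the \<open>f\<^sub>i\<close> are definable functions rather than function symbols, an \<open>L\<close>-formula
  expressing this is determined up to equivalence modulo the theory of \<open>M\<close>.
\<close>

definition composite_relation ::
    "('f, 'r, 's, 'a) struct \<Rightarrow> nat \<Rightarrow> ('f, 'r, 's) fm \<Rightarrow> (nat \<Rightarrow> 's var list) \<Rightarrow>
     (nat \<Rightarrow> 's var list) \<Rightarrow> (nat \<Rightarrow> nat) \<Rightarrow> (nat \<Rightarrow> nat) \<Rightarrow>
     (nat \<Rightarrow> 'a list \<Rightarrow> 'a list \<Rightarrow> 'a list) \<Rightarrow> 'a list set" where
  "composite_relation M d p x y s t f =
     {a 1 @ a 2 @ a 3 | a :: nat \<Rightarrow> 'a list.
        (\<forall>j\<in>{1, 2, 3}. a j \<in> tuples M (y j)) \<and>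
        sat_at M p (concat (map x [1..<Suc d]))
          (concat (map (\<lambda>i. f i (a (s i)) (a (t i))) [1..<Suc d]))}"

end

theory Submission
  imports Defs Complex_Main "HOL-Library.FuncSet" "HOL-Library.Nat_Bijection"
begin

text \<open>
  Group the functions by their arguments: \<open>\<psi>(a; b, c)\<close> says \<open>\<phi>(F(a, b), G(a, c), H(b, c))\<close>. On
  a grid \<open>(b\<^sub>i)\<^bsub>i<N\<^esub>\<close>, \<open>(c\<^sub>j)\<^bsub>j<n\<^esub>\<close> the pattern cut out by \<open>a\<close> has the form
  \<open>{(i, j). \<phi>(u\<^sub>i, v\<^sub>j, w\<^bsub>ij\<^esub>)}\<close> where only \<open>u\<close> and \<open>v\<close> depend on \<open>a\<close>, and it suffices to bound the
  number of such patterns for fixed \<open>w\<close> and arbitrary \<open>u\<close>, \<open>v\<close>. Choose \<open>n\<close> such that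
  \<open>\<phi>(u; v, w)\<close>, with \<open>u\<close> as object variable, shatters no sequence of length \<open>n\<close>. For a given tuple
  \<open>v = (v\<^sub>j)\<^bsub>j<n\<^esub>\<close> each row then realizes at most \<open>2\<^sup>n - 1\<close> patterns, and which ones is a
  dependent relation between \<open>v\<close> and \<open>(w\<^bsub>ij\<^esub>)\<^bsub>j<n\<^esub>\<close>. By the Sauer-Shelah lemma there are only
  polynomially many possibilities in \<open>N\<close> for the sequence of these sets of row patterns, hence at
  most \<open>poly(N) (2\<^sup>n - 1)\<^sup>N\<close> patterns altogether, which is less than \<open>2\<^bsup>nN\<^esup>\<close> for large \<open>N\<close>.
\<close>

section \<open>Shattering and counting\<close>

text \<open>Dependence is assumed for \<open>M0\<close> and for models on \<open>nat => 'a\<close>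
  only, whereas the conclusion is about models of the theory of \<open>M\<close> on any type, where
  only the first-order sentences true in \<open>M\<close> are available. The failure of shattering
  is therefore pinned to one grid whose size \<open>N\<close> times \<open>n\<close> is fixed in
  advance: that such a grid is shattered is a single \<open>L\<close>-sentence, and it is false in
  \<open>M\<close>. The counting itself takes place in \<open>M0\<close>, where the values of the
  functions are mere points. Allowing arbitrary u and v there removes the functions, and with them
  the language \<open>L\<close>, from the argument. The sets of row patterns are controlled by 2^n
  auxiliary formulas, one for each subset E of the columns, saying that some u realizes E in the
  row. Hence \<open>n\<close> has to be fixed before \<open>N\<close>. With a common bound k for
  these formulas, the polynomial has exponent k 2^n; losing one pattern in every row costs a factor
  1 - 2^(-n) per row, which is exponential in \<open>N\<close> and wins.\<close>

definition shattered_by :: "'b set set \<Rightarrow> 'b set \<Rightarrow> bool" where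
  "shattered_by F T \<longleftrightarrow> (\<forall>T'\<subseteq>T. \<exists>A\<in>F. A \<inter> T = T')"

lemma shattered_by_subset:
  assumes "shattered_by F T" "T' \<subseteq> T"
  shows "shattered_by F T'"
  unfolding shattered_by_def
proof (intro allI impI)
  fix Z assume "Z \<subseteq> T'"
  then obtain A where "A \<in> F" "A \<inter> T = Z"
    using assms unfolding shattered_by_def by (meson order_trans)
  then show "\<exists>A\<in>F. A \<inter> T' = Z" using assms \<open>Z \<subseteq> T'\<close> by blast
qed

text \<open>Pajor's form of the Sauer-Shelah lemma. Unlike the usual bound it goes through a plain
  induction on \<open>X\<close>, splitting the family at a point \<open>x\<close> into the members
  without \<open>x\<close> and the members with \<open>x\<close>, the latter stripped of
  \<open>x\<close>.\<close>

lemma card_le_card_shattered: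
  assumes "finite X" "F \<subseteq> Pow X"
  shows "card F \<le> card {T. T \<subseteq> X \<and> shattered_by F T}"
  using assms
proof (induction X arbitrary: F rule: finite_induct)
  case empty
  show ?case
  proof (cases "F = {}")
    case False
    with empty have F: "F = {{}}" by auto
    have "{T. T \<subseteq> {} \<and> shattered_by F T} = {{}}"
      by (auto simp: shattered_by_def F)
    then show ?thesis by (simp add: F)
  qed simp
next
  case (insert x X)
  define F0 where "F0 = {A. A \<subseteq> X \<and> A \<in> F}"
  define F1 where "F1 = {A. A \<subseteq> X \<and> insert x A \<in> F}"
  define S where "S = (\<lambda>G. {T. T \<subseteq> X \<and> shattered_by G T})"
  have fin: "finite F0" "finite F1" "finite (S F0)" "finite (S F1)"
    unfolding F0_def F1_def S_def using insert.hyps(1) by auto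
  have F: "F = F0 \<union> insert x ` F1"
  proof
    show "F \<subseteq> F0 \<union> insert x ` F1"
    proof
      fix A assume A: "A \<in> F"
      show "A \<in> F0 \<union> insert x ` F1"
      proof (cases "x \<in> A")
        case True
        then have "A = insert x (A - {x})" by auto
        moreover from this have "A - {x} \<in> F1" using A insert.prems by (auto simp: F1_def)
        ultimately show ?thesis by blast
      next
        case False
        then show ?thesis using A insert.prems by (auto simp: F0_def)
      qed
    qed
  qed (auto simp: F0_def F1_def)
  have inj: "inj_on (insert x) {A. A \<subseteq> X}"
    using insert.hyps(2) by (auto simp: inj_on_def insert_ident subset_iff)
  have "F0 \<inter> insert x ` F1 = {}" using insert.hyps(2) by (auto simp: F0_def)
  moreover have "inj_on (insert x) F1" by (rule inj_on_subset[OF inj]) (auto simp: F1_def)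
  ultimately have "card F = card F0 + card F1"
    using fin by (simp add: F card_Un_disjoint card_image)
  also have "\<dots> \<le> card (S F0) + card (S F1)"
    unfolding S_def by (intro add_mono insert.IH) (auto simp: F0_def F1_def)
  also have "\<dots> = card (S F0 \<union> S F1) + card (S F0 \<inter> S F1)"
    by (rule card_Un_Int[OF fin(3,4)])
  \<comment> \<open>A set \<open>T\<close> shattered by both halves is counted twice; its second
    count is charged to \<open>insert x T\<close>, which \<open>F\<close> shatters because each
    trace on \<open>T\<close> occurs both with and without \<open>x\<close>.\<close>
  also have "\<dots> = card (S F0 \<union> S F1) + card (insert x ` (S F0 \<inter> S F1))"
    by (subst card_image) (auto intro: inj_on_subset[OF inj] simp: S_def)
  also have "\<dots> = card ((S F0 \<union> S F1) \<union> insert x ` (S F0 \<inter> S F1))"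
    using fin insert.hyps(2) by (subst card_Un_disjoint) (auto simp: S_def)
  also have "\<dots> \<le> card {T. T \<subseteq> insert x X \<and> shattered_by F T}"
  proof (rule card_mono)
    show "finite {T. T \<subseteq> insert x X \<and> shattered_by F T}" using insert.hyps(1) by simp
    have "shattered_by F T" if "T \<in> S F0" for T
      using that unfolding S_def shattered_by_def F by blast
    moreover have "shattered_by F T" if T: "T \<in> S F1" for T
      unfolding shattered_by_def
    proof (intro allI impI)
      fix T' assume "T' \<subseteq> T"
      moreover have "shattered_by F1 T" "x \<notin> T" using T insert.hyps(2) by (auto simp: S_def)
      ultimately obtain A where "A \<in> F1" "A \<inter> T = T'" by (meson shattered_by_def)
      then have "insert x A \<inter> T = T'" "insert x A \<in> F" using \<open>x \<notin> T\<close> F by blast+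
      then show "\<exists>A\<in>F. A \<inter> T = T'" by blast
    qed
    moreover have "shattered_by F (insert x T)" if T: "T \<in> S F0 \<inter> S F1" for T
      unfolding shattered_by_def
    proof (intro allI impI)
      fix T' assume T': "T' \<subseteq> insert x T"
      have x: "x \<notin> T" using T insert.hyps(2) by (auto simp: S_def)
      show "\<exists>A\<in>F. A \<inter> insert x T = T'"
      proof (cases "x \<in> T'")
        case True
        have "T' - {x} \<subseteq> T" using T' by auto
        moreover have "shattered_by F1 T" using T by (simp add: S_def)
        ultimately obtain A where A: "A \<in> F1" "A \<inter> T = T' - {x}"
          by (meson shattered_by_def)
        have "insert x A \<inter> insert x T = T'" using A(2) True by blast
        moreover have "insert x A \<in> F" using A(1) F by blast
        ultimately show ?thesis by blast
      next
        case False
        then have "T' \<subseteq> T" using T' by auto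
        moreover have "shattered_by F0 T" using T by (simp add: S_def)
        ultimately obtain A where A: "A \<in> F0" "A \<inter> T = T'"
          by (meson shattered_by_def)
        have "x \<notin> A" "A \<in> F" using A(1) insert.hyps(2) by (auto simp: F0_def)
        then have "A \<inter> insert x T = T'" using A(2) by blast
        then show ?thesis using \<open>A \<in> F\<close> by blast
      qed
    qed
    ultimately show "(S F0 \<union> S F1) \<union> insert x ` (S F0 \<inter> S F1)
        \<subseteq> {T. T \<subseteq> insert x X \<and> shattered_by F T}"
      by (auto simp: S_def)
  qed
  finally show ?case .
qed

text \<open>A crude bound suffices. A set with fewer than \<open>k\<close> elements is listed by a
  function on \<open>{..<k}\<close>; the value \<open>N\<close>, outside \<open>{..<N}\<close>, pads
  the list, whence the base \<open>N + 1\<close>.\<close>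

lemma card_small_subsets_le:
  "card {T. T \<subseteq> {..<N} \<and> card T < k} \<le> (N + 1) ^ k"
proof -
  let ?P = "{..<k} \<rightarrow>\<^sub>E {..N}"
  have "{T. T \<subseteq> {..<N} \<and> card T < k} \<subseteq> (\<lambda>g. g ` {..<k} \<inter> {..<N}) ` ?P"
  proof
    fix T assume "T \<in> {T. T \<subseteq> {..<N} \<and> card T < k}"
    then have T: "T \<subseteq> {..<N}" "card T < k" by auto
    then obtain h where h: "bij_betw h {0..<card T} T"
      using ex_bij_betw_nat_finite finite_subset by blast
    define g where "g = (\<lambda>i\<in>{..<k}. if i < card T then h i else N)"
    have hT: "h i \<in> T" if "i < card T" for i
      using h that by (auto simp: bij_betw_def)
    have "g i \<le> N" if "i < k" for i
      using T hT[of i] by (force simp: g_def that)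
    then have "g \<in> ?P" by (auto simp: g_def PiE_iff)
    moreover have "g ` {..<k} \<inter> {..<N} = T"
    proof
      show "g ` {..<k} \<inter> {..<N} \<subseteq> T" using hT by (auto simp: g_def split: if_splits)
      show "T \<subseteq> g ` {..<k} \<inter> {..<N}"
      proof
        fix z assume "z \<in> T"
        then obtain i where "i < card T" "z = h i" using h by (fastforce simp: bij_betw_def)
        then show "z \<in> g ` {..<k} \<inter> {..<N}"
          using T \<open>z \<in> T\<close> by (auto simp: g_def intro!: image_eqI[of _ _ i])
      qed
    qed
    ultimately show "T \<in> (\<lambda>g. g ` {..<k} \<inter> {..<N}) ` ?P" by blast
  qed
  then have "card {T. T \<subseteq> {..<N} \<and> card T < k} \<le> card ?P"
    by (meson card_image_le card_mono finite_PiE finite_atMost finite_imageI finite_lessThan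
        order_trans)
  then show ?thesis by (simp add: card_PiE)
qed

text \<open>Excluding size exactly \<open>k\<close> excludes all larger sizes, since a larger
  shattered set has a shattered subset of size \<open>k\<close>.\<close>

lemma card_le_if_not_shattered:
  assumes "F \<subseteq> Pow {..<N}" and "\<And>T. T \<subseteq> {..<N} \<Longrightarrow> card T = k \<Longrightarrow> \<not> shattered_by F T"
  shows "card F \<le> (N + 1) ^ k"
proof -
  have "card F \<le> card {T. T \<subseteq> {..<N} \<and> shattered_by F T}"
    by (rule card_le_card_shattered) (use assms in auto)
  also have "\<dots> \<le> card {T. T \<subseteq> {..<N} \<and> card T < k}"
  proof (rule card_mono)
    show "{T. T \<subseteq> {..<N} \<and> shattered_by F T} \<subseteq> {T. T \<subseteq> {..<N} \<and> card T < k}"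
    proof (clarsimp, rule ccontr)
      fix T assume T: "T \<subseteq> {..<N}" "shattered_by F T" "\<not> card T < k"
      then obtain T' where "T' \<subseteq> T" "card T' = k"
        by (meson not_less obtain_subset_with_card_n)
      then show False using assms(2)[of T'] T shattered_by_subset by blast
    qed
  qed simp
  also have "\<dots> \<le> (N + 1) ^ k" by (rule card_small_subsets_le)
  finally show ?thesis .
qed

text \<open>After division by \<open>q ^ N\<close> the claim is (N+1)^m r^N < 1 with r = (q-1)/q. An
  m-th root \<open>z\<close> of r turns the left side into ((N+1) z^N)^m, so the limit of n z^n is
  enough.\<close>

lemma ex_poly_times_power_less:
  fixes m q :: nat
  assumes "q > 0"
  shows "\<exists>N. (N + 1) ^ m * (q - 1) ^ N < q ^ N"
proof (cases "m = 0 \<or> q = 1")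
  case True
  then show ?thesis using assms by (intro exI[of _ 1]) auto
next
  case False
  then have m: "m > 0" and q: "q > 1" using assms by auto
  define r where "r = real (q - 1) / real q"
  define z where "z = root m r"
  have r: "0 < r" "r < 1" using q by (auto simp: r_def field_simps)
  have z: "0 < z" "z < 1" "z ^ m = r" using r m by (auto simp: z_def)
  have "(\<lambda>n. real n * z ^ n) \<longlonglongrightarrow> 0" using powser_times_n_limit_0[of z] z by simp
  then have "(\<lambda>n. real (Suc n) * z ^ Suc n) \<longlonglongrightarrow> 0" by (rule LIMSEQ_Suc)
  \<comment> \<open>Comparing with \<open>z\<close> instead of 1 lets the surplus factor
    \<open>z\<close> be cancelled afterwards.\<close>
  then have "eventually (\<lambda>n. real (Suc n) * z ^ Suc n < z) sequentially"
    by (rule order_tendstoD) (use z in auto)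
  then obtain N where "real (Suc N) * z ^ Suc N < z"
    by (auto simp: eventually_sequentially)
  then have "real (N + 1) * z ^ N < 1"
    using z by (simp add: mult.left_commute[of _ z])
  then have "(real (N + 1) * z ^ N) ^ m < 1"
    using m z by (intro power_less_one_iff[THEN iffD2]) auto
  moreover have "(real (N + 1) * z ^ N) ^ m = real (N + 1) ^ m * r ^ N"
    by (simp add: power_mult_distrib mult.commute[of m N] flip: z(3) power_mult)
  ultimately have "real (N + 1) ^ m * r ^ N < 1" by argo
  then have "real (N + 1) ^ m * real (q - 1) ^ N < real q ^ N"
    using q by (simp add: r_def power_divide field_simps)
  then have "real ((N + 1) ^ m * (q - 1) ^ N) < real (q ^ N)" by simp
  then show ?thesis using of_nat_less_iff by blast
qed

text \<open>The combinatorial core, free of logic: \<open>X i\<close> stands for the set of patterns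
  realizable in row \<open>i\<close>, and \<open>XX\<close> for all such profiles. Each profile is
  determined by its 2^n traces, one for each \<open>E\<close>, and Sauer-Shelah bounds the number of
  traces for each \<open>E\<close>. As \<open>N\<close> depends on \<open>n\<close> and
  \<open>k\<close> only, it can be chosen before the structure supplies \<open>XX\<close>.\<close>

lemma ex_pattern_avoiding:
  fixes n k :: nat
  shows "\<exists>N. \<forall>XX :: (nat \<Rightarrow> nat set set) set.
    (\<forall>X\<in>XX. \<forall>i<N. X i \<subset> Pow {..<n}) \<longrightarrow>
    (\<forall>E T. E \<subseteq> {..<n} \<longrightarrow> T \<subseteq> {..<N} \<longrightarrow> card T = k \<longrightarrow>
       \<not> shattered_by ((\<lambda>X. {i. i < N \<and> E \<in> X i}) ` XX) T) \<longrightarrow>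
    (\<exists>S. (\<forall>i<N. S i \<subseteq> {..<n}) \<and> (\<forall>X\<in>XX. \<exists>i<N. S i \<notin> X i))"
proof -
  obtain N where N: "(N + 1) ^ (k * 2 ^ n) * (2 ^ n - 1) ^ N < (2 ^ n :: nat) ^ N"
    using ex_poly_times_power_less[of "2 ^ n" "k * 2 ^ n"] by auto
  show ?thesis
  proof (intro exI[of _ N] allI impI)
    fix XX :: "(nat \<Rightarrow> nat set set) set"
    assume X': "\<forall>X\<in>XX. \<forall>i<N. X i \<subset> Pow {..<n}"
      and sh: "\<forall>E T. E \<subseteq> {..<n} \<longrightarrow> T \<subseteq> {..<N} \<longrightarrow> card T = k \<longrightarrow>
         \<not> shattered_by ((\<lambda>X. {i. i < N \<and> E \<in> X i}) ` XX) T"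
    have X: "X i \<subset> Pow {..<n}" if "X \<in> XX" "i < N" for X i
      using X' that by simp
    define tr where "tr = (\<lambda>(E :: nat set) (X :: nat \<Rightarrow> nat set set). {i. i < N \<and> E \<in> X i})"
    define profiles where "profiles = (\<lambda>X. \<lambda>i\<in>{..<N}. X i) ` XX"
    have fin_tr: "finite (tr E ` XX)" for E
      by (rule finite_subset[of _ "Pow {..<N}"]) (auto simp: tr_def)
    \<comment> \<open>\<open>dec\<close> rebuilds a profile from its traces, so the profiles are at
      most as many as the families of traces in \<open>Q\<close>.\<close>
    define dec where "dec = (\<lambda>(g :: nat set \<Rightarrow> nat set). \<lambda>i\<in>{..<N}. {E. E \<subseteq> {..<n} \<and> i \<in> g E})"
    define Q where "Q = (\<Pi>\<^sub>E E\<in>Pow {..<n}. tr E ` XX)"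
    have finQ: "finite Q" unfolding Q_def by (rule finite_PiE) (use fin_tr in auto)
    have sub: "profiles \<subseteq> dec ` Q"
    proof
      fix Y assume "Y \<in> profiles"
      then obtain X where X': "X \<in> XX" "Y = (\<lambda>i\<in>{..<N}. X i)" by (auto simp: profiles_def)
      have "dec (\<lambda>E\<in>Pow {..<n}. tr E X) = Y"
      proof
        fix i
        show "dec (\<lambda>E\<in>Pow {..<n}. tr E X) i = Y i"
        proof (cases "i < N")
          case True
          then have "X i \<subseteq> Pow {..<n}" using X[OF X'(1)] by blast
          then show ?thesis using True by (auto simp: dec_def X'(2) tr_def)
        qed (simp add: dec_def X'(2))
      qed
      moreover have "(\<lambda>E\<in>Pow {..<n}. tr E X) \<in> Q" using X' by (auto simp: Q_def)
      ultimately show "Y \<in> dec ` Q" by blast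
    qed
    have finP: "finite profiles" using sub finQ finite_subset by blast
    have "card profiles \<le> card Q"
      by (rule order_trans[OF card_mono[OF _ sub] card_image_le[OF finQ]]) (use finQ in simp)
    also have "card Q = (\<Prod>E\<in>Pow {..<n}. card (tr E ` XX))"
      unfolding Q_def by (rule card_PiE) simp
    also have "\<dots> \<le> (\<Prod>E\<in>Pow {..<n}. (N + 1) ^ k)"
    proof (rule prod_mono, safe)
      fix E :: "nat set" assume "E \<subseteq> {..<n}"
      then show "card (tr E ` XX) \<le> (N + 1) ^ k"
        using sh[rule_format, of E]
        by (intro card_le_if_not_shattered) (auto simp: tr_def)
    qed
    also have "\<dots> = (N + 1) ^ (k * 2 ^ n)" by (simp add: card_Pow power_mult)
    finally have cP: "card profiles \<le> (N + 1) ^ (k * 2 ^ n)" .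
    \<comment> \<open>The union collects all choices of one pattern per row that some profile
      admits; the desired \<open>S\<close> is any choice outside it.\<close>
    have "card (\<Union>Y\<in>profiles. \<Pi>\<^sub>E i\<in>{..<N}. Y i) \<le> (\<Sum>Y\<in>profiles. card (\<Pi>\<^sub>E i\<in>{..<N}. Y i))"
      by (rule card_UN_le[OF finP])
    also have "\<dots> \<le> (\<Sum>Y\<in>profiles. (2 ^ n - 1) ^ N)"
    proof (rule sum_mono)
      fix Y assume "Y \<in> profiles"
      then have Y: "Y i \<subset> Pow {..<n}" if "i < N" for i
        using X[OF _ that] that by (force simp: profiles_def)
      have "card (Y i) \<le> 2 ^ n - 1" if "i < N" for i
        using psubset_card_mono[OF _ Y[OF that]] by (simp add: card_Pow)
      then have "(\<Prod>i\<in>{..<N}. card (Y i)) \<le> (\<Prod>i\<in>{..<N}. 2 ^ n - 1)"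
        by (intro prod_mono) auto
      then show "card (\<Pi>\<^sub>E i\<in>{..<N}. Y i) \<le> (2 ^ n - 1) ^ N" by (simp add: card_PiE)
    qed
    also have "\<dots> \<le> (N + 1) ^ (k * 2 ^ n) * (2 ^ n - 1) ^ N" using cP by simp
    also have "\<dots> < card (\<Pi>\<^sub>E i\<in>{..<N}. Pow {..<n})" using N by (simp add: card_PiE card_Pow)
    finally have lt: "card (\<Union>Y\<in>profiles. \<Pi>\<^sub>E i\<in>{..<N}. Y i) < card (\<Pi>\<^sub>E i\<in>{..<N}. Pow {..<n})" .
    have "finite (\<Union>Y\<in>profiles. \<Pi>\<^sub>E i\<in>{..<N}. Y i)"
    proof (rule finite_UN_I[OF finP], rule finite_PiE)
      fix Y i assume "Y \<in> profiles" "i \<in> {..<N}"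
      then have "Y i \<subseteq> Pow {..<n}" using X[of _ i] by (force simp: profiles_def)
      then show "finite (Y i)" by (rule finite_subset) simp
    qed simp
    then have "\<not> (\<Pi>\<^sub>E i\<in>{..<N}. Pow {..<n}) \<subseteq> (\<Union>Y\<in>profiles. \<Pi>\<^sub>E i\<in>{..<N}. Y i)"
      using lt by (meson card_mono leD)
    then obtain S where S: "S \<in> (\<Pi>\<^sub>E i\<in>{..<N}. Pow {..<n})"
      and S': "S \<notin> (\<Union>Y\<in>profiles. \<Pi>\<^sub>E i\<in>{..<N}. Y i)"
      by (meson subsetI)
    have nS: "S \<notin> (\<Pi>\<^sub>E i\<in>{..<N}. Y i)" if "Y \<in> profiles" for Y
      using S' that by (meson UN_I)
    have "\<exists>i<N. S i \<notin> X i" if "X \<in> XX" for X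
    proof (rule ccontr)
      assume "\<not> (\<exists>i<N. S i \<notin> X i)"
      then have "S \<in> (\<Pi>\<^sub>E i\<in>{..<N}. (\<lambda>i\<in>{..<N}. X i) i)"
        using S by (auto simp: PiE_iff)
      moreover have "(\<lambda>i\<in>{..<N}. X i) \<in> profiles" using that by (simp add: profiles_def)
      ultimately show False using nS by blast
    qed
    then show "\<exists>S. (\<forall>i<N. S i \<subseteq> {..<n}) \<and> (\<forall>X\<in>XX. \<exists>i<N. S i \<notin> X i)"
      using S by (intro exI[of _ S]) auto
  qed
qed

section \<open>Syntax and satisfaction\<close>

lemma eval_tm_cong:
  "(\<And>v. v \<in> fv_tm t \<Longrightarrow> e v = e' v) \<Longrightarrow> eval_tm M e t = eval_tm M e' t"
proof (induction t)
  case (Fn g ts)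
  then have "map (eval_tm M e) ts = map (eval_tm M e') ts" by (intro map_cong) auto
  then show ?case by (simp only: eval_tm.simps)
qed simp

lemma sat_cong:
  "(\<And>v. v \<in> fv p \<Longrightarrow> e v = e' v) \<Longrightarrow> sat M e p \<longleftrightarrow> sat M e' p"
proof (induction p arbitrary: e e')
  case (Eq t u)
  then have "eval_tm M e t = eval_tm M e' t" "eval_tm M e u = eval_tm M e' u"
    by (intro eval_tm_cong; simp)+
  then show ?case by simp
next
  case (Rel r ts)
  then have "\<forall>t\<in>set ts. eval_tm M e t = eval_tm M e' t"
    by (auto intro!: eval_tm_cong)
  then have "map (eval_tm M e) ts = map (eval_tm M e') ts" by simp
  then show ?case by (simp only: sat.simps)
next
  case (Neg p)
  show ?case using Neg.IH[of e e'] Neg.prems by simp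
next
  case (And p q)
  have "sat M e p \<longleftrightarrow> sat M e' p" "sat M e q \<longleftrightarrow> sat M e' q"
    using And.IH(1)[of e e'] And.IH(2)[of e e'] And.prems by simp_all
  then show ?case by simp
next
  case (Ex v p)
  have "sat M (e(v := a)) p \<longleftrightarrow> sat M (e'(v := a)) p" for a
    using Ex.prems by (intro Ex.IH) auto
  then show ?case by (simp del: fun_upd_apply)
qed

lemma finite_fv_tm: "finite (fv_tm t)"
  by (induction t) auto

lemma finite_fv: "finite (fv p)"
  by (induction p) (auto simp: finite_fv_tm)

lemma fv_tm_subset_vars: "is_term L t \<Longrightarrow> fv_tm t \<subseteq> vars L"
proof (induction t)
  case (Fn g ts)
  then show ?case by (fastforce simp: list_all_iff)
qed simp

lemma fv_subset_vars: "is_formula L p \<Longrightarrow> fv p \<subseteq> vars L"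
proof (induction p)
  case (Rel r ts)
  then show ?case using fv_tm_subset_vars by (fastforce simp: list_all_iff)
next
  case (Eq t u)
  then show ?case using fv_tm_subset_vars by fastforce
qed auto

lemma sat_at_iff:
  assumes "distinct vs" "fv p \<subseteq> set vs"
  shows "sat_at M p vs (map e vs) \<longleftrightarrow> sat M e p"
proof
  assume "sat_at M p vs (map e vs)"
  then obtain e' where "map e' vs = map e vs" "sat M e' p" by (auto simp: sat_at_def)
  then show "sat M e p" using assms sat_cong[of p e e' M] by fastforce
qed (auto simp: sat_at_def)

section \<open>Sublanguages and expansions\<close>

lemma tm_sort_sublanguage:
  "sublanguage L0 L \<Longrightarrow> is_term L0 t \<Longrightarrow> tm_sort L t = tm_sort L0 t"
  by (cases t) (auto simp: sublanguage_def)

lemma is_term_sublanguage: "sublanguage L0 L \<Longrightarrow> is_term L0 t \<Longrightarrow> is_term L t"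
proof (induction t)
  case (Var v)
  then show ?case by (auto simp: sublanguage_def vars_def)
next
  case (Fn g ts)
  then have "map (tm_sort L) ts = map (tm_sort L0) ts"
    by (intro map_cong refl tm_sort_sublanguage) (auto simp: list_all_iff)
  moreover have "\<forall>t\<in>set ts. is_term L t" using Fn by (auto simp: list_all_iff)
  moreover have "g \<in> fun_syms L" "fun_dom L g = fun_dom L0 g"
    using Fn.prems by (auto simp: sublanguage_def)
  ultimately show ?case using Fn.prems by (simp add: list_all_iff del: map_eq_conv)
qed

lemma is_formula_sublanguage: "sublanguage L0 L \<Longrightarrow> is_formula L0 p \<Longrightarrow> is_formula L p"
proof (induction p)
  case (Eq t u)
  then show ?case by (auto simp: is_term_sublanguage tm_sort_sublanguage)
next
  case (Rel r ts)
  then have "map (tm_sort L) ts = map (tm_sort L0) ts"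
    by (intro map_cong refl tm_sort_sublanguage) (auto simp: list_all_iff)
  moreover have "\<forall>t\<in>set ts. is_term L t"
    using Rel is_term_sublanguage by (auto simp: list_all_iff)
  moreover have "r \<in> rel_syms L" "rel_dom L r = rel_dom L0 r"
    using Rel.prems by (auto simp: sublanguage_def)
  ultimately show ?case using Rel.prems by (simp add: list_all_iff del: map_eq_conv)
next
  case (Ex v p)
  then show ?case by (auto simp: sublanguage_def vars_def)
qed auto

text \<open>Only variables of sorts of \<open>L\<close> are constrained, because a structure may
  have empty carriers at other sorts.\<close>

definition assignments :: "('f, 'r, 's) language \<Rightarrow> ('f, 'r, 's, 'a) struct \<Rightarrow> ('s var \<Rightarrow> 'a) set" where
  "assignments L M = {e. \<forall>v\<in>vars L. e v \<in> carrier M (var_sort v)}"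

lemma assignments_nonempty: "is_struct L M \<Longrightarrow> \<exists>e. e \<in> assignments L M"
  unfolding assignments_def is_struct_def vars_def
  by (intro exI[of _ "\<lambda>v. SOME a. a \<in> carrier M (var_sort v)"]) (auto simp: some_in_eq)

lemma assignments_override_on:
  "e \<in> assignments L M \<Longrightarrow> (\<And>v. v \<in> A \<Longrightarrow> e' v \<in> carrier M (var_sort v)) \<Longrightarrow>
    override_on e e' A \<in> assignments L M"
  by (auto simp: assignments_def override_on_def)

lemma map_in_tuples_iff:
  "map e vs \<in> tuples M vs \<longleftrightarrow> (\<forall>v\<in>set vs. e v \<in> carrier M (var_sort v))"
  by (auto simp: tuples_def sort_tuples_def list_all2_map1 list_all2_map2 list_all2_same)

text \<open>The interpretations agree on well-sorted arguments only, so the induction has to carry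
  along that values lie in the right carriers.\<close>

lemma expansion_eval_tm:
  assumes "expansion L0 M0 L M" "e \<in> assignments L0 M0"
  shows "is_term L0 t \<Longrightarrow>
    eval_tm M e t = eval_tm M0 e t \<and> eval_tm M0 e t \<in> carrier M0 (tm_sort L0 t)"
proof (induction t)
  case (Var v)
  then show ?case using assms by (auto simp: assignments_def)
next
  case (Fn g ts)
  then have ts: "map (eval_tm M e) ts = map (eval_tm M0 e) ts"
    and g: "g \<in> fun_syms L0" by (auto simp: list_all_iff)
  have "list_all2 (\<lambda>a s. a \<in> carrier M0 s) (map (eval_tm M0 e) ts) (map (tm_sort L0) ts)"
    unfolding list_all2_map1 list_all2_map2 list_all2_same using Fn by (auto simp: list_all_iff)
  then have "map (eval_tm M0 e) ts \<in> sort_tuples M0 (fun_dom L0 g)"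
    using Fn.prems by (auto simp: sort_tuples_def)
  then show ?case
    using assms(1) g ts by (auto simp: expansion_def is_struct_def simp del: map_eq_conv)
qed

lemma expansion_sat:
  assumes "expansion L0 M0 L M"
  shows "e \<in> assignments L0 M0 \<Longrightarrow> is_formula L0 p \<Longrightarrow> sat M e p \<longleftrightarrow> sat M0 e p"
proof (induction p arbitrary: e)
  case (Eq t u)
  then show ?case using expansion_eval_tm[OF assms] by simp
next
  case (Rel r ts)
  then have ts: "map (eval_tm M e) ts = map (eval_tm M0 e) ts"
    using expansion_eval_tm[OF assms] by (auto simp: list_all_iff)
  have "list_all2 (\<lambda>a s. a \<in> carrier M0 s) (map (eval_tm M0 e) ts) (map (tm_sort L0) ts)"
    unfolding list_all2_map1 list_all2_map2 list_all2_same
    using Rel expansion_eval_tm[OF assms] by (auto simp: list_all_iff)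
  then have "map (eval_tm M0 e) ts \<in> sort_tuples M0 (rel_dom L0 r)"
    using Rel by (auto simp: sort_tuples_def)
  then show ?case using assms Rel ts by (auto simp: expansion_def simp del: map_eq_conv)
next
  case (Ex v p)
  have "carrier M (var_sort v) = carrier M0 (var_sort v)"
    using assms Ex.prems by (auto simp: expansion_def vars_def)
  moreover have "sat M (e(v := a)) p \<longleftrightarrow> sat M0 (e(v := a)) p"
    if "a \<in> carrier M0 (var_sort v)" for a
    using Ex.prems that by (intro Ex.IH) (auto simp: assignments_def)
  ultimately show ?case by auto
qed auto

section \<open>Building formulas\<close>

definition Exs :: "'s var list \<Rightarrow> ('f, 'r, 's) fm \<Rightarrow> ('f, 'r, 's) fm" where
  "Exs vs p = foldr Ex vs p"

text \<open>The syntax has no constant for truth, so the conjunction starts from the head and is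
  meant for nonempty lists.\<close>

definition Conjs :: "('f, 'r, 's) fm list \<Rightarrow> ('f, 'r, 's) fm" where
  "Conjs ps = foldr And (tl ps) (hd ps)"

lemma fv_Exs: "fv (Exs vs p) = fv p - set vs"
  by (induction vs) (auto simp: Exs_def)

lemma is_formula_Exs: "is_formula L (Exs vs p) \<longleftrightarrow> is_formula L p \<and> set vs \<subseteq> vars L"
  by (induction vs) (auto simp: Exs_def)

lemma sat_Exs:
  "sat M e (Exs vs p) \<longleftrightarrow>
    (\<exists>e'. (\<forall>v\<in>set vs. e' v \<in> carrier M (var_sort v)) \<and> sat M (override_on e e' (set vs)) p)"
proof (induction vs arbitrary: e)
  case Nil
  then show ?case by (simp add: Exs_def)
next
  case (Cons w vs)
  have "sat M e (Exs (w # vs) p) \<longleftrightarrow>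
      (\<exists>a\<in>carrier M (var_sort w). sat M (e(w := a)) (Exs vs p))"
    by (simp add: Exs_def)
  also have "\<dots> \<longleftrightarrow> (\<exists>e'. (\<forall>v\<in>set (w # vs). e' v \<in> carrier M (var_sort v)) \<and>
      sat M (override_on e e' (set (w # vs))) p)" (is "?l \<longleftrightarrow> ?r")
  proof
    assume ?l
    then obtain a e' where a: "a \<in> carrier M (var_sort w)"
      and e': "\<forall>v\<in>set vs. e' v \<in> carrier M (var_sort v)"
        "sat M (override_on (e(w := a)) e' (set vs)) p"
      using Cons.IH by blast
    \<comment> \<open>The list may repeat \<open>w\<close>; then the inner quantifier overwrites the
      outer one, and the value \<open>a\<close> must not be used.\<close>
    have "override_on (e(w := a)) e' (set vs) =
        override_on e (if w \<in> set vs then e' else e'(w := a)) (set (w # vs))"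
      by (auto simp: override_on_def fun_eq_iff)
    then show ?r using a e'
      by (intro exI[of _ "if w \<in> set vs then e' else e'(w := a)"]) auto
  next
    assume ?r
    then obtain e' where e': "\<forall>v\<in>set (w # vs). e' v \<in> carrier M (var_sort v)"
      "sat M (override_on e e' (set (w # vs))) p" by blast
    then show ?l by (intro bexI[of _ "e' w"]) (auto simp: Cons.IH override_on_insert' simp del: fun_upd_apply)
  qed
  finally show ?case .
qed

lemma fv_foldr_And: "fv (foldr And ps p) = fv p \<union> (\<Union>q\<in>set ps. fv q)"
  by (induction ps) auto

lemma is_formula_foldr_And:
  "is_formula L (foldr And ps p) \<longleftrightarrow> is_formula L p \<and> (\<forall>q\<in>set ps. is_formula L q)"
  by (induction ps) auto

lemma sat_foldr_And: "sat M e (foldr And ps p) \<longleftrightarrow> sat M e p \<and> (\<forall>q\<in>set ps. sat M e q)"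
  by (induction ps) auto

lemma fv_Conjs: "ps \<noteq> [] \<Longrightarrow> fv (Conjs ps) = (\<Union>q\<in>set ps. fv q)"
  by (cases ps) (auto simp: Conjs_def fv_foldr_And)

lemma is_formula_Conjs: "ps \<noteq> [] \<Longrightarrow> is_formula L (Conjs ps) \<longleftrightarrow> (\<forall>q\<in>set ps. is_formula L q)"
  by (cases ps) (auto simp: Conjs_def is_formula_foldr_And)

lemma sat_Conjs: "ps \<noteq> [] \<Longrightarrow> sat M e (Conjs ps) \<longleftrightarrow> (\<forall>q\<in>set ps. sat M e q)"
  by (cases ps) (auto simp: Conjs_def sat_foldr_And)

section \<open>Substitution and formulas expressing patterns\<close>

text \<open>
  Substitution by quantifying over the old variables cannot capture: \<open>\<rho> v\<close> only occurs outside
  the scope of the quantifiers of \<open>p\<close>.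
\<close>

definition rename :: "'s var list \<Rightarrow> ('s var \<Rightarrow> 's var) \<Rightarrow> ('f, 'r, 's) fm \<Rightarrow> ('f, 'r, 's) fm" where
  "rename vs \<rho> p = Exs vs (foldr And (map (\<lambda>v. Eq (Var v) (Var (\<rho> v))) vs) p)"

lemma fv_rename: "fv (rename vs \<rho> p) \<subseteq> (fv p - set vs) \<union> \<rho> ` set vs"
  by (auto simp: rename_def fv_Exs fv_foldr_And)

lemma is_formula_rename:
  assumes "is_formula L p" "set vs \<subseteq> vars L" "\<And>v. v \<in> set vs \<Longrightarrow> var_sort (\<rho> v) = var_sort v"
  shows "is_formula L (rename vs \<rho> p)"
  using assms by (auto simp: rename_def is_formula_Exs is_formula_foldr_And vars_def)

text \<open>The equations between \<open>v\<close> and \<open>\<rho> v\<close> leave a single choice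
  for the quantified variables, because every \<open>\<rho> v\<close> stays outside them. Membership
  in the carriers makes that choice admissible.\<close>

lemma sat_rename:
  assumes "\<And>v. v \<in> set vs \<Longrightarrow> \<rho> v \<notin> set vs \<and> e (\<rho> v) \<in> carrier M (var_sort v)"
  shows "sat M e (rename vs \<rho> p) \<longleftrightarrow> sat M (override_on e (e \<circ> \<rho>) (set vs)) p"
proof -
  have *: "override_on e e' (set vs) = override_on e (e \<circ> \<rho>) (set vs)"
    if "\<forall>v\<in>set vs. override_on e e' (set vs) v = override_on e e' (set vs) (\<rho> v)" for e'
    using that assms by (fastforce simp: override_on_def fun_eq_iff)
  have "sat M e (rename vs \<rho> p) \<longleftrightarrow> (\<exists>e'. (\<forall>v\<in>set vs. e' v \<in> carrier M (var_sort v)) \<and>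
      (\<forall>v\<in>set vs. override_on e e' (set vs) v = override_on e e' (set vs) (\<rho> v)) \<and>
      sat M (override_on e e' (set vs)) p)"
    by (auto simp: rename_def sat_Exs sat_foldr_And)
  also have "\<dots> \<longleftrightarrow> sat M (override_on e (e \<circ> \<rho>) (set vs)) p"
    (is "?l \<longleftrightarrow> ?r")
  proof
    assume ?l
    then show ?r using * by metis
  next
    assume ?r
    then show ?l using assms by (intro exI[of _ "e \<circ> \<rho>"]) simp
  qed
  finally show ?thesis .
qed

text \<open>The variables \<open>us\<close> hold the object tuple, and \<open>\<rho> j\<close> holds
  the parameter tuple number \<open>j\<close> that replaces \<open>vs\<close>. The index type is
  left open since the formula serves both for one row of a grid and for a whole grid.\<close>

definition pattern_fm ::
    "'s var list \<Rightarrow> 's var list \<Rightarrow> ('i \<Rightarrow> 's var \<Rightarrow> 's var) \<Rightarrow> 'i list \<Rightarrow> ('f, 'r, 's) fm \<Rightarrow> 'i set \<Rightarrow>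
     ('f, 'r, 's) fm" where
  "pattern_fm us vs \<rho> J p E =
     Exs us (Conjs (map (\<lambda>j. (if j \<in> E then id else Neg) (rename vs (\<rho> j) p)) J))"

lemma fv_pattern_fm:
  "J \<noteq> [] \<Longrightarrow> fv (pattern_fm us vs \<rho> J p E) \<subseteq>
    (fv p - set us - set vs) \<union> (\<Union>j\<in>set J. \<rho> j ` set vs)"
  using fv_rename[of vs _ p] by (fastforce simp: pattern_fm_def fv_Exs fv_Conjs split: if_splits)

lemma is_formula_pattern_fm:
  assumes "J \<noteq> []" "is_formula L p" "set us \<subseteq> vars L" "set vs \<subseteq> vars L"
    "\<And>j v. j \<in> set J \<Longrightarrow> v \<in> set vs \<Longrightarrow> var_sort (\<rho> j v) = var_sort v"
  shows "is_formula L (pattern_fm us vs \<rho> J p E)"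
  using assms by (auto simp: pattern_fm_def is_formula_Exs is_formula_Conjs is_formula_rename)

lemma sat_pattern_fm:
  assumes "J \<noteq> []" "set us \<inter> set vs = {}"
    "\<And>j v. j \<in> set J \<Longrightarrow> v \<in> set vs \<Longrightarrow>
       \<rho> j v \<notin> set us \<union> set vs \<and> e (\<rho> j v) \<in> carrier M (var_sort v)"
  shows "sat M e (pattern_fm us vs \<rho> J p E) \<longleftrightarrow>
    (\<exists>e'. (\<forall>v\<in>set us. e' v \<in> carrier M (var_sort v)) \<and>
       (\<forall>j\<in>set J. sat M (override_on (override_on e (e \<circ> \<rho> j) (set vs)) e' (set us)) p
          \<longleftrightarrow> j \<in> E))"
proof -
  have "sat M (override_on e e' (set us)) (rename vs (\<rho> j) p) \<longleftrightarrow>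
      sat M (override_on (override_on e (e \<circ> \<rho> j) (set vs)) e' (set us)) p"
    if "j \<in> set J" for e' j
  proof -
    \<comment> \<open>The two updates can be interchanged since the copies avoid \<open>us\<close>
      and \<open>vs\<close>.\<close>
    have "override_on (override_on e e' (set us)) (override_on e e' (set us) \<circ> \<rho> j) (set vs) =
        override_on (override_on e (e \<circ> \<rho> j) (set vs)) e' (set us)"
      using assms that by (fastforce simp: override_on_def fun_eq_iff)
    then show ?thesis
      using assms that by (subst sat_rename) (auto simp: override_on_def)
  qed
  then show ?thesis
    using assms(1) by (auto simp: pattern_fm_def sat_Exs sat_Conjs) 
qed

section \<open>Ultrapowers\<close>

text \<open>Infinitude of the members expresses properness and nonprincipality at once.\<close>

definition free_ultrafilter :: "nat set set \<Rightarrow> bool" where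
  "free_ultrafilter U \<longleftrightarrow>
     (\<forall>A\<in>U. infinite A) \<and> (\<forall>A\<in>U. \<forall>B\<in>U. A \<inter> B \<in> U) \<and>
     (\<forall>A\<in>U. \<forall>B. A \<subseteq> B \<longrightarrow> B \<in> U) \<and> (\<forall>A. A \<in> U \<or> - A \<in> U)"

text \<open>Zorn's lemma is applied to families whose finite intersections are all infinite, rather
  than to filters: unions of chains are then immediate. If a maximal family had neither
  \<open>A\<close> nor its complement, two finite subfamilies would have intersections almost
  disjoint from \<open>A\<close> and from \<open>- A\<close>, and together a finite
  intersection.\<close>

lemma ex_free_ultrafilter: "\<exists>U. free_ultrafilter U"
proof -
  define P where "P = {F :: nat set set. \<forall>G. finite G \<and> G \<subseteq> F \<longrightarrow> infinite (\<Inter>G)}"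
  have "\<exists>F\<in>P. \<forall>G\<in>P. F \<subseteq> G \<longrightarrow> G = F"
  proof (rule subset_Zorn_nonempty)
    show "P \<noteq> {}" by (auto simp: P_def intro!: exI[of _ "{}"])
    fix C assume C: "C \<noteq> {}" "subset.chain P C"
    show "\<Union>C \<in> P"
      unfolding P_def
    proof (clarsimp)
      fix G assume G: "finite G" "G \<subseteq> \<Union>C" "finite (\<Inter>G)"
      then obtain F where "F \<in> C" "G \<subseteq> F"
        using finite_subset_Union_chain[OF G(1,2) C] by blast
      then show False using C G by (auto simp: P_def subset_chain_def)
    qed
  qed
  then obtain U where U: "U \<in> P" and mx: "\<And>G. G \<in> P \<Longrightarrow> U \<subseteq> G \<Longrightarrow> G = U" by blast
  have fip: "infinite (\<Inter>G)" if "finite G" "G \<subseteq> U" for G using U that by (auto simp: P_def)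
  have fin: "\<exists>G. finite G \<and> G \<subseteq> U \<and> finite (\<Inter>G \<inter> A)" if "A \<notin> U" for A
  proof -
    have "insert A U \<notin> P" using mx[of "insert A U"] that by auto
    then obtain G where G: "finite G" "G \<subseteq> insert A U" "finite (\<Inter>G)" by (auto simp: P_def)
    have "\<Inter>(G - {A}) \<inter> A \<subseteq> \<Inter>G" by auto
    then show ?thesis using G by (intro exI[of _ "G - {A}"]) (auto intro: finite_subset)
  qed
  have ult: "A \<in> U \<or> - A \<in> U" for A
  proof (rule ccontr)
    assume "\<not> (A \<in> U \<or> - A \<in> U)"
    then obtain G H where G: "finite G" "G \<subseteq> U" "finite (\<Inter>G \<inter> A)"
      and H: "finite H" "H \<subseteq> U" "finite (\<Inter>H \<inter> - A)"
      using fin[of A] fin[of "- A"] by auto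
    have "\<Inter>(G \<union> H) \<subseteq> (\<Inter>G \<inter> A) \<union> (\<Inter>H \<inter> - A)" by auto
    then have "finite (\<Inter>(G \<union> H))" using G H by (meson finite_UnI finite_subset)
    then show False using fip[of "G \<union> H"] G H by auto
  qed
  have "B \<in> U" if "finite G" "G \<subseteq> U" "\<Inter>G \<subseteq> B" for G B
  proof (rule ccontr)
    assume "B \<notin> U"
    then have "- B \<in> U" using ult by blast
    then have "infinite (\<Inter>(insert (- B) G))" using that by (intro fip) auto
    moreover have "\<Inter>(insert (- B) G) = {}" using that by auto
    ultimately show False by simp
  qed note up = this
  have "free_ultrafilter U"
    unfolding free_ultrafilter_def
  proof (intro conjI ballI allI impI)
    show "infinite A" if "A \<in> U" for A using fip[of "{A}"] that by simp
    show "A \<inter> B \<in> U" if "A \<in> U" "B \<in> U" for A B using up[of "{A, B}"] that by simp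
    show "B \<in> U" if "A \<in> U" "A \<subseteq> B" for A B using up[of "{A}"] that by simp
    show "A \<in> U \<or> - A \<in> U" for A by (rule ult)
  qed
  then show ?thesis by blast
qed

definition uequiv :: "nat set set \<Rightarrow> (nat \<Rightarrow> 'a) \<Rightarrow> (nat \<Rightarrow> 'a) \<Rightarrow> bool" where
  "uequiv U g h \<longleftrightarrow> {k. g k = h k} \<in> U"

text \<open>Elements of the ultrapower are chosen representatives instead of equivalence classes, so
  that they keep the type \<open>nat => 'a\<close> at which dependence is assumed.\<close>

definition urep :: "nat set set \<Rightarrow> (nat \<Rightarrow> 'a) \<Rightarrow> nat \<Rightarrow> 'a" where
  "urep U g = (SOME h. uequiv U g h)"

text \<open>A representative may leave the carrier of \<open>M\<close> at indices outside some set
  in the ultrafilter. The carrier is therefore the image of the everywhere well-sorted sequences,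
  not a set of such sequences.\<close>

definition ultrapower ::
    "nat set set \<Rightarrow> ('f, 'r, 's, 'a) struct \<Rightarrow> ('f, 'r, 's, nat \<Rightarrow> 'a) struct" where
  "ultrapower U M =
     \<lparr>carrier = \<lambda>s. urep U ` {g. \<forall>k. g k \<in> carrier M s},
      fun_int = \<lambda>h as. urep U (\<lambda>k. fun_int M h (map (\<lambda>a. a k) as)),
      rel_int = \<lambda>r as. {k. rel_int M r (map (\<lambda>a. a k) as)} \<in> U\<rparr>"

lemma ultrapower_simps:
  "carrier (ultrapower U M) s = urep U ` {g. \<forall>k. g k \<in> carrier M s}"
  "fun_int (ultrapower U M) h as = urep U (\<lambda>k. fun_int M h (map (\<lambda>a. a k) as))"
  "rel_int (ultrapower U M) r as \<longleftrightarrow> {k. rel_int M r (map (\<lambda>a. a k) as)} \<in> U"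
  by (simp_all add: ultrapower_def)

context
  fixes U :: "nat set set"
  assumes U: "free_ultrafilter U"
begin

section \<open>Properties of ultrafilters and the theorem of Los\<close>

lemma U_mono: "A \<in> U \<Longrightarrow> A \<subseteq> B \<Longrightarrow> B \<in> U"
  using U unfolding free_ultrafilter_def by blast

lemma U_Int_iff: "A \<inter> B \<in> U \<longleftrightarrow> A \<in> U \<and> B \<in> U"
  using U unfolding free_ultrafilter_def by (meson inf_le1 inf_le2)

lemma U_Compl_iff: "- A \<in> U \<longleftrightarrow> A \<notin> U"
proof -
  have "A \<inter> - A \<notin> U" using U unfolding free_ultrafilter_def by force
  then show ?thesis using U U_Int_iff unfolding free_ultrafilter_def by blast
qed

lemma U_cofinite: "finite (- A) \<Longrightarrow> A \<in> U"
  using U U_Compl_iff unfolding free_ultrafilter_def by blast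

lemma U_finite_INT: "finite I \<Longrightarrow> (\<And>i. i \<in> I \<Longrightarrow> A i \<in> U) \<Longrightarrow> {k. \<forall>i\<in>I. k \<in> A i} \<in> U"
proof (induction I rule: finite_induct)
  case empty
  then show ?case by (auto intro: U_cofinite)
next
  case (insert i I)
  have "{k. \<forall>j\<in>insert i I. k \<in> A j} = A i \<inter> {k. \<forall>j\<in>I. k \<in> A j}" by auto
  then show ?case using insert by (simp add: U_Int_iff)
qed

lemma U_cong: "{k. P k = Q k} \<in> U \<Longrightarrow> {k. P k} \<in> U \<longleftrightarrow> {k. Q k} \<in> U"
proof -
  assume "{k. P k = Q k} \<in> U"
  moreover have "{k. P k = Q k} \<inter> {k. P k} \<subseteq> {k. Q k}" "{k. P k = Q k} \<inter> {k. Q k} \<subseteq> {k. P k}"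
    by auto
  ultimately show ?thesis by (meson U_Int_iff U_mono)
qed

lemma uequiv_refl: "uequiv U g g"
  by (auto simp: uequiv_def intro: U_cofinite)

lemma uequiv_sym: "uequiv U g h \<Longrightarrow> uequiv U h g"
  by (simp add: uequiv_def eq_commute)

lemma uequiv_trans: "uequiv U f g \<Longrightarrow> uequiv U g h \<Longrightarrow> uequiv U f h"
  unfolding uequiv_def by (erule U_mono[OF U_Int_iff[THEN iffD2], OF conjI]) auto

lemma uequiv_urep: "uequiv U g (urep U g)"
  unfolding urep_def by (rule someI[where P = "uequiv U g"], rule uequiv_refl)

lemma urep_eq_iff: "urep U g = urep U h \<longleftrightarrow> uequiv U g h"
proof
  assume "urep U g = urep U h"
  then show "uequiv U g h"
    using uequiv_urep[of g] uequiv_urep[of h] by (metis uequiv_sym uequiv_trans)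
next
  assume "uequiv U g h"
  then have "uequiv U g = uequiv U h" using uequiv_sym uequiv_trans by blast
  then show "urep U g = urep U h" by (simp add: urep_def)
qed

text \<open>An argument list is finite, so its representatives agree with the original sequences
  simultaneously on a set in \<open>U\<close>.\<close>

lemma map_urep_in_U:
  "{k. map (\<lambda>a. a k) (map (\<lambda>x. urep U (g x)) xs) = map (\<lambda>x. g x k) xs} \<in> U"
proof -
  have "{k. \<forall>x\<in>set xs. k \<in> {k. g x k = urep U (g x) k}} \<in> U"
    using uequiv_urep by (intro U_finite_INT) (auto simp: uequiv_def)
  then show ?thesis by (rule U_mono) auto
qed

lemma eval_tm_ultrapower:
  "eval_tm (ultrapower U M) (\<lambda>v. urep U (g v)) t = urep U (\<lambda>k. eval_tm M (\<lambda>v. g v k) t)"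
proof (induction t)
  case (Fn h ts)
  then have "map (eval_tm (ultrapower U M) (\<lambda>v. urep U (g v))) ts =
      map (\<lambda>t. urep U (\<lambda>k. eval_tm M (\<lambda>v. g v k) t)) ts"
    by simp
  moreover have "uequiv U
      (\<lambda>k. fun_int M h (map (\<lambda>a. a k) (map (\<lambda>t. urep U (\<lambda>k. eval_tm M (\<lambda>v. g v k) t)) ts)))
      (\<lambda>k. fun_int M h (map (\<lambda>t. eval_tm M (\<lambda>v. g v k) t) ts))"
    unfolding uequiv_def
    by (rule U_mono[OF map_urep_in_U[of "\<lambda>t k. eval_tm M (\<lambda>v. g v k) t" ts]])
      (auto simp del: map_map)
  ultimately show ?case by (simp add: ultrapower_simps urep_eq_iff del: map_map map_eq_conv)
qed simp

text \<open>The theorem of Los. It needs no well-sortedness of \<open>g\<close>, which keeps the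
  induction free of side conditions on the assignment.\<close>

lemma sat_ultrapower:
  assumes "is_struct L M"
  shows "is_formula L p \<Longrightarrow>
    sat (ultrapower U M) (\<lambda>v. urep U (g v)) p \<longleftrightarrow> {k. sat M (\<lambda>v. g v k) p} \<in> U"
proof (induction p arbitrary: g)
  case (Eq t u)
  then show ?case by (simp add: eval_tm_ultrapower urep_eq_iff uequiv_def)
next
  case (Rel r ts)
  have "map (eval_tm (ultrapower U M) (\<lambda>v. urep U (g v))) ts =
      map (\<lambda>t. urep U (\<lambda>k. eval_tm M (\<lambda>v. g v k) t)) ts"
    by (simp add: eval_tm_ultrapower)
  moreover have "{k. rel_int M r (map (\<lambda>a. a k)
        (map (\<lambda>t. urep U (\<lambda>k. eval_tm M (\<lambda>v. g v k) t)) ts))} \<in> U \<longleftrightarrow>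
      {k. rel_int M r (map (\<lambda>t. eval_tm M (\<lambda>v. g v k) t) ts)} \<in> U"
    by (rule U_cong,
        rule U_mono[OF map_urep_in_U[of "\<lambda>t k. eval_tm M (\<lambda>v. g v k) t" ts]])
      (auto simp del: map_map)
  ultimately show ?case by (simp add: ultrapower_simps del: map_map map_eq_conv)
next
  case (Neg p)
  then show ?case
    using U_Compl_iff[of "{k. sat M (\<lambda>v. g v k) p}"] by (simp add: Compl_eq)
next
  case (And p q)
  then show ?case
    using U_Int_iff[of "{k. sat M (\<lambda>v. g v k) p}" "{k. sat M (\<lambda>v. g v k) q}"]
    by (simp add: Int_def)
next
  case (Ex w p)
  let ?s = "var_sort w"
  have upd: "(\<lambda>v. urep U (g v))(w := urep U h) = (\<lambda>v. urep U ((g(w := h)) v))" for h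
    by (simp add: fun_eq_iff)
  have pt: "(\<lambda>v. (g(w := h)) v k) = (\<lambda>v. g v k)(w := h k)" for h k
    by (simp add: fun_eq_iff)
  have IH: "sat (ultrapower U M) ((\<lambda>v. urep U (g v))(w := urep U h)) p \<longleftrightarrow>
      {k. sat M ((\<lambda>v. g v k)(w := h k)) p} \<in> U" for h
    using Ex.IH[of "g(w := h)"] Ex.prems unfolding upd pt by simp
  have ne: "carrier M ?s \<noteq> {}" using assms Ex.prems by (auto simp: is_struct_def vars_def)
  have "sat (ultrapower U M) (\<lambda>v. urep U (g v)) (Ex w p) \<longleftrightarrow>
      (\<exists>h. (\<forall>k. h k \<in> carrier M ?s) \<and>
        sat (ultrapower U M) ((\<lambda>v. urep U (g v))(w := urep U h)) p)"
    by (auto simp: ultrapower_simps simp del: fun_upd_apply)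
  also have "\<dots> \<longleftrightarrow>
      (\<exists>h. (\<forall>k. h k \<in> carrier M ?s) \<and> {k. sat M ((\<lambda>v. g v k)(w := h k)) p} \<in> U)"
    by (simp only: IH)
  also have "\<dots> \<longleftrightarrow> {k. \<exists>a\<in>carrier M ?s. sat M ((\<lambda>v. g v k)(w := a)) p} \<in> U"
    (is "_ \<longleftrightarrow> ?K \<in> U")
  proof
    assume K: "?K \<in> U"
    \<comment> \<open>Indices without a witness receive any element of the carrier, so that
      \<open>h\<close> is well-sorted at every index.\<close>
    have "\<forall>k. \<exists>a. a \<in> carrier M ?s \<and> (k \<in> ?K \<longrightarrow> sat M ((\<lambda>v. g v k)(w := a)) p)"
      using ne by (auto simp del: fun_upd_apply)
    from choice[OF this] obtain h where h: "\<And>k. h k \<in> carrier M ?s"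
      "\<And>k. k \<in> ?K \<Longrightarrow> sat M ((\<lambda>v. g v k)(w := h k)) p"
      by blast
    have "{k. sat M ((\<lambda>v. g v k)(w := h k)) p} \<in> U"
      by (rule U_mono[OF K], rule subsetI, rule CollectI, rule h(2))
    then show "\<exists>h. (\<forall>k. h k \<in> carrier M ?s) \<and> {k. sat M ((\<lambda>v. g v k)(w := h k)) p} \<in> U"
      using h(1) by blast
  next
    assume "\<exists>h. (\<forall>k. h k \<in> carrier M ?s) \<and> {k. sat M ((\<lambda>v. g v k)(w := h k)) p} \<in> U"
    then show "?K \<in> U" by (elim exE conjE, elim U_mono) blast
  qed
  finally show ?case by simp
qed

lemma is_struct_ultrapower:
  assumes "is_struct L M"
  shows "is_struct L (ultrapower U M)"
  unfolding is_struct_def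
proof (intro conjI ballI)
  fix s assume "s \<in> sorts L"
  then obtain a where "a \<in> carrier M s" using assms by (metis is_struct_def ex_in_conv)
  then have "urep U (\<lambda>_. a) \<in> carrier (ultrapower U M) s" by (auto simp: ultrapower_simps)
  then show "carrier (ultrapower U M) s \<noteq> {}" by blast
next
  fix h as assume h: "h \<in> fun_syms L" and as: "as \<in> sort_tuples (ultrapower U M) (fun_dom L h)"
  let ?n = "length as"
  have len: "length (fun_dom L h) = ?n"
    using as by (auto simp: sort_tuples_def list_all2_lengthD)
  have "\<exists>g. as ! i = urep U g \<and> (\<forall>k. g k \<in> carrier M (fun_dom L h ! i))" if "i < ?n" for i
    using as that by (auto simp: sort_tuples_def list_all2_conv_all_nth ultrapower_simps)
  then obtain g where g: "\<And>i. i < ?n \<Longrightarrow> as ! i = urep U (g i)"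
    "\<And>i k. i < ?n \<Longrightarrow> g i k \<in> carrier M (fun_dom L h ! i)"
    by metis
  have as_eq: "as = map (\<lambda>i. urep U (g i)) [0..<?n]" by (rule nth_equalityI) (auto simp: g(1))
  have "uequiv U (\<lambda>k. fun_int M h (map (\<lambda>a. a k) as)) (\<lambda>k. fun_int M h (map (\<lambda>i. g i k) [0..<?n]))"
    unfolding uequiv_def
    by (subst as_eq, rule U_mono[OF map_urep_in_U[of g "[0..<?n]"]]) (auto simp del: map_map)
  then have "fun_int (ultrapower U M) h as = urep U (\<lambda>k. fun_int M h (map (\<lambda>i. g i k) [0..<?n]))"
    by (simp add: ultrapower_simps urep_eq_iff)
  moreover have "fun_int M h (map (\<lambda>i. g i k) [0..<?n]) \<in> carrier M (fun_cod L h)" for k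
    using assms h g(2) len
    by (auto simp: is_struct_def sort_tuples_def list_all2_conv_all_nth)
  ultimately show "fun_int (ultrapower U M) h as \<in> carrier (ultrapower U M) (fun_cod L h)"
    by (auto simp: ultrapower_simps)
qed

lemma is_model_ultrapower:
  assumes "is_struct L M"
  shows "is_model L (Th L M) (ultrapower U M)"
  unfolding is_model_def
proof (intro conjI ballI allI)
  show "is_struct L (ultrapower U M)" by (rule is_struct_ultrapower[OF assms])
  fix p e assume p: "p \<in> Th L M"
  \<comment> \<open>An arbitrary assignment need not consist of representatives; a sentence may be
    tested at one that does.\<close>
  have "sat (ultrapower U M) (\<lambda>v. urep U ((\<lambda>_. undefined) v)) p"
    using p by (subst sat_ultrapower[OF assms]) (auto simp: Th_def intro: U_cofinite)
  then show "sat (ultrapower U M) e p"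
    using p sat_cong[of p e "\<lambda>v. urep U ((\<lambda>_. undefined) v)"] by (auto simp: Th_def)
qed

end

section \<open>Uniform bounds from dependence\<close>

text \<open>A bound on shattering with the variables in \<open>A\<close> as object variables and
  \<open>S\<close> as an unrealized pattern. Whole assignments replace tuples, so a partition of the
  variables is just a set \<open>A\<close>, and assignments can be recombined without regard to
  lengths.\<close>

definition vc_bound ::
    "('f, 'r, 's) language \<Rightarrow> ('f, 'r, 's, 'a) struct \<Rightarrow> 's var set \<Rightarrow> ('f, 'r, 's) fm \<Rightarrow> nat \<Rightarrow> bool"
  where
  "vc_bound L M A p k \<longleftrightarrow>
     (\<forall>b. (\<forall>i. b i \<in> assignments L M) \<longrightarrow>
       (\<exists>S. \<forall>e\<in>assignments L M. \<exists>i<k. sat M (override_on (b i) e A) p \<noteq> (i \<in> S)))"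

lemma vc_bound_mono:
  fixes M :: "('f, 'r, 's, 'a) struct"
  assumes "vc_bound L M A p k" "k \<le> k'"
  shows "vc_bound L M A p k'"
  unfolding vc_bound_def
proof (intro allI impI)
  fix b :: "nat \<Rightarrow> 's var \<Rightarrow> 'a" assume "\<forall>i. b i \<in> assignments L M"
  then obtain S where "\<forall>e\<in>assignments L M. \<exists>i<k. sat M (override_on (b i) e A) p \<noteq> (i \<in> S)"
    using assms(1) unfolding vc_bound_def by blast
  then have "\<forall>e\<in>assignments L M. \<exists>i<k'. sat M (override_on (b i) e A) p \<noteq> (i \<in> S)"
    using assms(2) order_less_le_trans by blast
  then show "\<exists>S. \<forall>e\<in>assignments L M. \<exists>i<k'. sat M (override_on (b i) e A) p \<noteq> (i \<in> S)" ..
qed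

text \<open>
  If the \<open>k\<close>-th coordinate of a sequence in the ultrapower runs through a sequence of length
  \<open>k\<close> that is shattered in \<open>M\<close>, then the sequence itself is shattered.
\<close>

lemma dependent_structure_vc_bound:
  fixes M :: "('f, 'r, 's, 'a) struct"
  assumes M: "is_struct L M" and dep: "dependent_structure TYPE(nat \<Rightarrow> 'a) L M"
    and p: "is_formula L p"
  shows "\<exists>k. vc_bound L M A p k"
proof (rule ccontr)
  assume no_bound: "\<nexists>k. vc_bound L M A p k"
  have "\<forall>k :: nat. \<exists>b. (\<forall>i. b i \<in> assignments L M) \<and>
      (\<forall>S. \<exists>e\<in>assignments L M. \<forall>i<k. sat M (override_on (b i) e A) p \<longleftrightarrow> i \<in> S)"
  proof
    fix k :: nat
    have "\<not> vc_bound L M A p k" using no_bound by simp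
    then show "\<exists>b. (\<forall>i. b i \<in> assignments L M) \<and>
        (\<forall>S. \<exists>e\<in>assignments L M. \<forall>i<k. sat M (override_on (b i) e A) p \<longleftrightarrow> i \<in> S)"
      unfolding vc_bound_def by simp
  qed
  from choice[OF this] obtain b where
    b': "\<forall>k :: nat. (\<forall>i. b k i \<in> assignments L M) \<and>
      (\<forall>S. \<exists>e\<in>assignments L M. \<forall>i<k. sat M (override_on (b k i) e A) p \<longleftrightarrow> i \<in> S)" ..
  then have b: "b k i \<in> assignments L M" for k i by simp
  have ex_e: "\<exists>e. e \<in> assignments L M \<and>
      (\<forall>i<k. sat M (override_on (b k i) e A) p \<longleftrightarrow> i \<in> S)" for k S
    using b' by (simp add: Bex_def)
  define e where "e k S = (SOME e. e \<in> assignments L M \<and>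
      (\<forall>i<k. sat M (override_on (b k i) e A) p \<longleftrightarrow> i \<in> S))" for k S
  have e: "e k S \<in> assignments L M"
    and sat_e: "i < k \<Longrightarrow> sat M (override_on (b k i) (e k S) A) p \<longleftrightarrow> i \<in> S" for k S i
    using someI_ex[OF ex_e[of k S]] unfolding e_def[symmetric] by simp_all
  obtain us where us: "set us = A \<inter> fv p" "distinct us"
    using finite_distinct_list[of "A \<inter> fv p"] finite_fv by blast
  obtain ws where ws: "set ws = fv p - A" "distinct ws"
    using finite_distinct_list[of "fv p - A"] finite_fv by blast
  have vars: "fv p \<subseteq> vars L" by (rule fv_subset_vars[OF p])
  have part: "partitioned_formula L p us [ws]"
    using p us ws vars by (auto simp: partitioned_formula_def)
  obtain U where U: "free_ultrafilter U" using ex_free_ultrafilter by blast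
  let ?N = "ultrapower U M"
  \<comment> \<open>Coordinate \<open>k\<close> combines entry \<open>i\<close> of the
    \<open>k\<close>-th shattered sequence with the realizer of \<open>S\<close>. On
    \<open>A\<close> it depends on \<open>S\<close> alone, off \<open>A\<close> on \<open>i\<close>
    alone; this permits the choices of \<open>{}\<close> and 0 below.\<close>
  define G where "G i S v = (\<lambda>k. override_on (b k i) (e k S) A v)" for i S v
  have G_in: "urep U (G i S v) \<in> carrier ?N (var_sort v)" if "v \<in> fv p" for i S v
  proof -
    have "G i S v k \<in> carrier M (var_sort v)" for k
      using that b e vars by (auto simp: G_def override_on_def assignments_def)
    then show ?thesis by (auto simp: ultrapower_simps)
  qed
  have sat_G: "sat ?N (\<lambda>v. urep U (G i S v)) p \<longleftrightarrow> i \<in> S" for i S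
  proof -
    have "sat ?N (\<lambda>v. urep U (G i S v)) p \<longleftrightarrow> {k. sat M (\<lambda>v. G i S v k) p} \<in> U"
      by (rule sat_ultrapower[OF U M p])
    also have "\<dots> \<longleftrightarrow> {k. i \<in> S} \<in> U"
    proof (rule U_cong[OF U], rule U_mono[OF U])
      \<comment> \<open>Entry \<open>i\<close> belongs to the shattered initial segment of the
        \<open>k\<close>-th sequence as soon as \<open>k > i\<close>.\<close>
      show "{i<..} \<in> U" by (rule U_cofinite[OF U]) (simp add: Compl_eq not_less)
      show "{i<..} \<subseteq> {k. sat M (\<lambda>v. G i S v k) p = (i \<in> S)}"
        using sat_e by (auto simp: G_def)
    qed
    also have "\<dots> \<longleftrightarrow> i \<in> S"
      using U_cofinite[OF U, of UNIV] U_Compl_iff[OF U, of UNIV] by (cases "i \<in> S") auto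
    finally show ?thesis .
  qed
  have "shatters_in ?N p us [ws]"
    unfolding shatters_in_def
  proof (intro exI conjI allI impI)
    let ?a = "\<lambda>(j :: nat) i. map (\<lambda>v. urep U (G i {} v)) ws"
    show "?a j i \<in> tuples ?N ([ws] ! j)" if "j < length [ws]" for j i
      using that ws G_in by (simp add: map_in_tuples_iff)
    fix S :: "nat list set"
    let ?S = "{i. [i] \<in> S}"
    let ?b = "map (\<lambda>v. urep U (G 0 ?S v)) us"
    have "?b \<in> tuples ?N us" using us G_in by (simp add: map_in_tuples_iff)
    moreover have "sat_at ?N p (us @ concat [ws])
        (?b @ concat (map (\<lambda>j. ?a j (I ! j)) [0..<length [ws]])) \<longleftrightarrow> I \<in> S"
      if "length I = length [ws]" for I
    proof -
      obtain i where I: "I = [i]" using \<open>length I = length [ws]\<close> by (auto simp: length_Suc_conv)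
      have "?b = map (\<lambda>v. urep U (G i ?S v)) us"
        using us by (auto simp: G_def)
      moreover have "map (\<lambda>v. urep U (G i {} v)) ws = map (\<lambda>v. urep U (G i ?S v)) ws"
        using ws by (auto simp: G_def)
      ultimately have "?b @ concat (map (\<lambda>j. ?a j (I ! j)) [0..<length [ws]]) =
          map (\<lambda>v. urep U (G i ?S v)) (us @ concat [ws])"
        by (simp add: I)
      then show ?thesis
        using us ws sat_G[of i ?S] by (simp only:) (subst sat_at_iff, auto simp: I)
    qed
    ultimately show "\<exists>b\<in>tuples ?N us. \<forall>I. length I = length [ws] \<longrightarrow>
        (sat_at ?N p (us @ concat [ws]) (b @ concat (map (\<lambda>j. ?a j (I ! j)) [0..<length [ws]]))
          \<longleftrightarrow> I \<in> S)"
      by blast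
  qed
  then have "has_independence_property TYPE(nat \<Rightarrow> 'a) L (Th L M) p us [ws]"
    using is_model_ultrapower[OF U M] by (auto simp: has_independence_property_def)
  then show False
    using dep part by (auto simp: n_dependent_structure_def n_dependent_theory_def
        n_dependent_formula_def)
qed

section \<open>Patterns on grids\<close>

text \<open>The offset \<open>K\<close> keeps copies away from a given finite set, the pairing keeps
  copies with different \<open>j\<close> apart, and the sort is preserved.\<close>

definition copy :: "nat \<Rightarrow> nat \<Rightarrow> 's var \<Rightarrow> 's var" where
  "copy K j v = (K + prod_encode (j, fst v), var_sort v)"

definition copy_index :: "nat \<Rightarrow> 's var \<Rightarrow> nat" where
  "copy_index K z = fst (prod_decode (fst z - K))"

definition copied_var :: "nat \<Rightarrow> 's var \<Rightarrow> 's var" where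
  "copied_var K z = (snd (prod_decode (fst z - K)), var_sort z)"

lemma copy_simps [simp]:
  "copy_index K (copy K j v) = j" "copied_var K (copy K j v) = v"
  "var_sort (copy K j v) = var_sort v" "var_sort (copied_var K z) = var_sort z"
  by (simp_all add: copy_def copy_index_def copied_var_def)

lemma copy_eq_iff [simp]: "copy K i v = copy K j w \<longleftrightarrow> i = j \<and> v = w"
  by (metis copy_simps(1,2))

lemma ex_fresh_copy: "finite V \<Longrightarrow> \<exists>K. \<forall>j v. copy K j v \<notin> V"
proof -
  assume "finite V"
  then have "finite (fst ` V)" by simp
  then obtain K where K: "\<forall>m\<in>fst ` V. m < K"
    unfolding finite_nat_set_iff_bounded by (rule exE)
  have "copy K j v \<notin> V" for j v
  proof
    assume "copy K j v \<in> V"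
    then have "fst (copy K j v) < K" using K by simp
    then show False by (simp add: copy_def)
  qed
  then show ?thesis by (intro exI allI)
qed

lemma copied_var_in_vars_iff [simp]: "copied_var K z \<in> vars L \<longleftrightarrow> z \<in> vars L"
  by (simp add: vars_def copied_var_def)

lemma copy_in_vars_iff [simp]: "copy K j v \<in> vars L \<longleftrightarrow> v \<in> vars L"
  by (simp add: vars_def copy_def)

text \<open>Packs a family of assignments into one. The result is well-sorted also at variables that
  are not copies, because decoding never changes the sort.\<close>

lemma assignments_copied:
  assumes "\<And>j. v j \<in> assignments L M"
  shows "(\<lambda>z. v (copy_index K z) (copied_var K z)) \<in> assignments L M"
  unfolding assignments_def
proof (intro CollectI ballI)
  fix z assume "z \<in> vars L"
  then have "copied_var K z \<in> vars L" by simp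
  then have "v (copy_index K z) (copied_var K z) \<in> carrier M (var_sort (copied_var K z))"
    using assms unfolding assignments_def by blast
  then show "v (copy_index K z) (copied_var K z) \<in> carrier M (var_sort z)" by simp
qed

text \<open>
  In the proof, \<open>V\<close> and \<open>W i\<close> encode the tuples \<open>(v\<^sub>j)\<^bsub>j<n\<^esub>\<close> and \<open>(w\<^bsub>ij\<^esub>)\<^bsub>j<n\<^esub>\<close> as single
  assignments of the copied variables, and \<open>X V i\<close> is the set of patterns realized in row \<open>i\<close>.
\<close>

lemma grid_pattern_not_realized:
  fixes L :: "('f, 'r, 's) language" and M :: "('f, 'r, 's, 'a) struct"
  assumes M: "is_struct L M" and nip: "\<And>A q. is_formula L q \<Longrightarrow> \<exists>k. vc_bound L M A q k"
    and p: "is_formula L p"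
  shows "\<exists>(n :: nat) (N :: nat). n > 0 \<and> N > 0 \<and> (\<forall>w. (\<forall>i j. w i j \<in> assignments L M) \<longrightarrow>
    (\<exists>S. \<forall>u v. (\<forall>i. u i \<in> assignments L M) \<longrightarrow> (\<forall>j. v j \<in> assignments L M) \<longrightarrow>
      (\<exists>i<N. \<exists>j<n.
        sat M (override_on (override_on (w i j) (v j) B) (u i) A) p \<noteq> ((i, j) \<in> S))))"
proof -
  obtain n0 where "vc_bound L M A p n0" using nip[OF p, of A] by (rule exE)
  \<comment> \<open>The successor makes the row nonempty, as the conjunction in the pattern formula
    requires.\<close>
  then have n: "vc_bound L M A p (Suc n0)" by (rule vc_bound_mono) simp
  define n where "n = Suc n0"
  obtain us where us: "set us = A \<inter> fv p" using finite_list[of "A \<inter> fv p"] finite_fv by blast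
  obtain vs where vs: "set vs = fv p - A" using finite_list[of "fv p - A"] finite_fv by blast
  have vars: "fv p \<subseteq> vars L" by (rule fv_subset_vars[OF p])
  obtain K where K: "\<forall>j v. copy K j v \<notin> fv p"
    using ex_fresh_copy[OF finite_fv[of p]] by (rule exE)
  define \<chi> where "\<chi> E = pattern_fm us vs (copy K) [0..<n] p E" for E
  \<comment> \<open>In the row formulas the copies of \<open>B\<close> become the object variables,
    filled by \<open>V\<close>; the other copies are parameters, filled by
    \<open>W i\<close>.\<close>
  define A' where "A' = (\<Union>j. copy K j ` B)"
  have "is_formula L (\<chi> E)" for E
    unfolding \<chi>_def using p us vs vars by (intro is_formula_pattern_fm) (auto simp: n_def)
  then have "\<forall>E. \<exists>k. vc_bound L M A' (\<chi> E) k" by (simp add: nip)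
  from choice[OF this] obtain kk where "\<forall>E. vc_bound L M A' (\<chi> E) (kk E)" by (rule exE)
  then have kk: "vc_bound L M A' (\<chi> E) (kk E)" for E by simp
  \<comment> \<open>One bound for all 2^n row formulas.\<close>
  define k where "k = Max (kk ` Pow {..<n})"
  have k: "vc_bound L M A' (\<chi> E) k" if "E \<subseteq> {..<n}" for E
    using that by (intro vc_bound_mono[OF kk]) (auto simp: k_def)
  obtain N where N: "\<forall>XX :: (nat \<Rightarrow> nat set set) set.
      (\<forall>X\<in>XX. \<forall>i<N. X i \<subset> Pow {..<n}) \<longrightarrow>
      (\<forall>E T. E \<subseteq> {..<n} \<longrightarrow> T \<subseteq> {..<N} \<longrightarrow> card T = k \<longrightarrow>
         \<not> shattered_by ((\<lambda>X. {i. i < N \<and> E \<in> X i}) ` XX) T) \<longrightarrow>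
      (\<exists>S. (\<forall>i<N. S i \<subseteq> {..<n}) \<and> (\<forall>X\<in>XX. \<exists>i<N. S i \<notin> X i))"
    using ex_pattern_avoiding[of n k] by (rule exE)
  obtain e0 where e0: "e0 \<in> assignments L M" using assignments_nonempty[OF M] by blast
  have main: "\<exists>S. \<forall>u v. (\<forall>i. u i \<in> assignments L M) \<longrightarrow> (\<forall>j. v j \<in> assignments L M) \<longrightarrow>
      (\<exists>i<N. \<exists>j<n.
        sat M (override_on (override_on (w i j) (v j) B) (u i) A) p \<noteq> ((i, j) \<in> S))"
    if w: "\<And>i j. w i j \<in> assignments L M" for w
  proof -
    define W where "W i z = w i (copy_index K z) (copied_var K z)" for i z
    have W: "W i \<in> assignments L M" for i
      unfolding W_def using w by (rule assignments_copied)
    define Y where "Y V i j e = override_on (override_on (w i j) (V \<circ> copy K j) B) e A"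
      for V i j e
    have sat_\<chi>: "sat M (override_on (W i) V A') (\<chi> E) \<longleftrightarrow>
        (\<exists>e\<in>assignments L M. \<forall>j<n. sat M (Y V i j e) p \<longleftrightarrow> j \<in> E)"
      if V: "V \<in> assignments L M" for V i E
    proof -
      let ?e = "override_on (W i) V A'"
      have e: "?e \<in> assignments L M" using V W by (auto simp: assignments_def override_on_def)
      have "copy K j v \<in> A' \<longleftrightarrow> v \<in> B" for j v by (auto simp: A'_def)
      then have eq: "sat M (override_on (override_on ?e (?e \<circ> copy K j) (set vs)) e (set us)) p
          \<longleftrightarrow> sat M (Y V i j e) p" for j e
        using us vs by (intro sat_cong) (auto simp: override_on_def Y_def W_def)
      have "sat M ?e (\<chi> E) \<longleftrightarrow> (\<exists>e'. (\<forall>v\<in>set us. e' v \<in> carrier M (var_sort v)) \<and>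
          (\<forall>j\<in>set [0..<n].
            sat M (override_on (override_on ?e (?e \<circ> copy K j) (set vs)) e' (set us)) p
              \<longleftrightarrow> j \<in> E))"
        unfolding \<chi>_def
      proof (rule sat_pattern_fm)
        fix j v assume "v \<in> set vs"
        then have "copy K j v \<in> vars L" using vs vars by auto
        then have "?e (copy K j v) \<in> carrier M (var_sort (copy K j v))"
          using e unfolding assignments_def by blast
        then show "copy K j v \<notin> set us \<union> set vs \<and> ?e (copy K j v) \<in> carrier M (var_sort v)"
          using K[rule_format, of j v] us vs by simp
      qed (use us vs in \<open>auto simp: n_def\<close>)
      also have "\<dots> \<longleftrightarrow> (\<exists>e'. (\<forall>v\<in>set us. e' v \<in> carrier M (var_sort v)) \<and>
          (\<forall>j<n. sat M (Y V i j e') p \<longleftrightarrow> j \<in> E))"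
        unfolding eq by (simp add: Ball_def)
      also have "\<dots> \<longleftrightarrow> (\<exists>e\<in>assignments L M. \<forall>j<n. sat M (Y V i j e) p \<longleftrightarrow> j \<in> E)"
        (is "?l \<longleftrightarrow> ?r")
      proof
        assume ?l
        then obtain e' where e': "\<forall>v\<in>set us. e' v \<in> carrier M (var_sort v)"
          "\<forall>j<n. sat M (Y V i j e') p \<longleftrightarrow> j \<in> E"
          by blast
        have "override_on e0 e' (set us) \<in> assignments L M"
          using e0 e' by (intro assignments_override_on) auto
        moreover have "sat M (Y V i j (override_on e0 e' (set us))) p \<longleftrightarrow> sat M (Y V i j e') p" for j
          using us by (intro sat_cong) (auto simp: override_on_def Y_def)
        ultimately show ?r using e'(2) by blast
      next
        assume ?r
        then obtain e' where e': "e' \<in> assignments L M" "\<forall>j<n. sat M (Y V i j e') p \<longleftrightarrow> j \<in> E"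
          by (rule bexE)
        have "\<forall>v\<in>set us. e' v \<in> carrier M (var_sort v)"
          using e'(1) us vars by (auto simp: assignments_def)
        then show ?l using e'(2) by blast
      qed
      finally show ?thesis .
    qed
    define X where "X V i = {E. E \<subseteq> {..<n} \<and> sat M (override_on (W i) V A') (\<chi> E)}" for V i
    have X: "X V i \<subset> Pow {..<n}" if V: "V \<in> assignments L M" for V i
    proof
      show "X V i \<subseteq> Pow {..<n}" by (auto simp: X_def)
      have "V (copy K j v) \<in> carrier M (var_sort v)" if "v \<in> vars L" for j v
      proof -
        have "copy K j v \<in> vars L" using that by simp
        then have "V (copy K j v) \<in> carrier M (var_sort (copy K j v))"
          using V unfolding assignments_def by blast
        then show ?thesis by simp
      qed
      \<comment> \<open>For fixed \<open>V\<close> the parameters along row \<open>i\<close> form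
        one sequence, so the bound \<open>n\<close> leaves some pattern of the row
        unrealized.\<close>
      then have "\<forall>j. override_on (w i j) (V \<circ> copy K j) B \<in> assignments L M"
        using w by (simp add: assignments_def override_on_def)
      from n[unfolded vc_bound_def, THEN spec, THEN mp, OF this]
      obtain S where S: "\<forall>e\<in>assignments L M. \<exists>j<n. sat M (Y V i j e) p \<noteq> (j \<in> S)"
        unfolding Y_def n_def by (rule exE)
      have "S \<inter> {..<n} \<notin> X V i"
      proof
        assume "S \<inter> {..<n} \<in> X V i"
        then obtain e where e: "e \<in> assignments L M"
          "\<forall>j<n. sat M (Y V i j e) p \<longleftrightarrow> j \<in> S \<inter> {..<n}"
          unfolding X_def using sat_\<chi>[OF V] by auto
        then show False using bspec[OF S e(1)] by auto
      qed
      then show "X V i \<noteq> Pow {..<n}" by blast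
    qed
    have not_sh: "\<not> shattered_by ((\<lambda>X. {i. i < N \<and> E \<in> X i}) ` X ` assignments L M) T"
      if E: "E \<subseteq> {..<n}" and T: "T \<subseteq> {..<N}" "card T = k" for E T
    proof
      assume sh: "shattered_by ((\<lambda>X. {i. i < N \<and> E \<in> X i}) ` X ` assignments L M) T"
      \<comment> \<open>Enumerating \<open>T\<close> turns a shattered set of rows into a shattered
        sequence of parameters \<open>W (h m)\<close> of length \<open>k\<close>.\<close>
      obtain h where h: "bij_betw h {0..<k} T"
        using ex_bij_betw_nat_finite[of T] T finite_subset by blast
      have "\<forall>m. W (h m) \<in> assignments L M" using W by simp
      from k[OF E, unfolded vc_bound_def, THEN spec, THEN mp, OF this]
      obtain S where S: "\<forall>e\<in>assignments L M.
          \<exists>m<k. sat M (override_on (W (h m)) e A') (\<chi> E) \<noteq> (m \<in> S)"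
        by (rule exE)
      have "h ` (S \<inter> {0..<k}) \<subseteq> T" using h by (auto simp: bij_betw_def)
      from sh[unfolded shattered_by_def, THEN spec, THEN mp, OF this]
      obtain V where V: "V \<in> assignments L M"
        "{i. i < N \<and> E \<in> X V i} \<inter> T = h ` (S \<inter> {0..<k})"
        unfolding image_image by (elim bexE imageE) simp
      have "sat M (override_on (W (h m)) V A') (\<chi> E) \<longleftrightarrow> m \<in> S" if m: "m < k" for m
      proof -
        have hm: "h m \<in> T" using h m by (auto simp: bij_betw_def)
        then have "sat M (override_on (W (h m)) V A') (\<chi> E) \<longleftrightarrow>
            h m \<in> {i. i < N \<and> E \<in> X V i} \<inter> T"
          using E T by (auto simp: X_def)
        also have "\<dots> \<longleftrightarrow> m \<in> S"
          unfolding V(2) using h m by (auto simp: bij_betw_def inj_on_def)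
        finally show ?thesis .
      qed
      then show False using bspec[OF S V(1)] by blast
    qed
    have "\<forall>X'\<in>X ` assignments L M. \<forall>i<N. X' i \<subset> Pow {..<n}" using X by simp
    moreover have "\<forall>E T. E \<subseteq> {..<n} \<longrightarrow> T \<subseteq> {..<N} \<longrightarrow> card T = k \<longrightarrow>
        \<not> shattered_by ((\<lambda>X. {i. i < N \<and> E \<in> X i}) ` X ` assignments L M) T"
      using not_sh by simp
    ultimately have "\<exists>S. (\<forall>i<N. S i \<subseteq> {..<n}) \<and>
        (\<forall>X'\<in>X ` assignments L M. \<exists>i<N. S i \<notin> X' i)"
      by (rule N[THEN spec, THEN mp, THEN mp])
    then obtain S where S: "\<forall>i<N. S i \<subseteq> {..<n}"
      and S': "\<forall>X'\<in>X ` assignments L M. \<exists>i<N. S i \<notin> X' i"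
      by (elim exE conjE)
    show ?thesis
    proof (intro exI[of _ "{(i, j). j \<in> S i}"] allI impI)
      fix u v :: "nat \<Rightarrow> 's var \<Rightarrow> 'a"
      assume u: "\<forall>i. u i \<in> assignments L M" and v: "\<forall>j. v j \<in> assignments L M"
      define V where "V z = v (copy_index K z) (copied_var K z)" for z
      have V: "V \<in> assignments L M"
        unfolding V_def using v by (intro assignments_copied) simp
      have Vj: "V \<circ> copy K j = v j" for j by (auto simp: V_def)
      obtain i where i: "i < N" "S i \<notin> X V i" using S' V by blast
      then have "\<not> (\<forall>j<n. sat M (Y V i j (u i)) p \<longleftrightarrow> j \<in> S i)"
        using S[rule_format, of i] u by (auto simp: X_def sat_\<chi>[OF V])
      then show "\<exists>i<N. \<exists>j<n.
          sat M (override_on (override_on (w i j) (v j) B) (u i) A) p \<noteq> ((i, j) \<in> {(i, j). j \<in> S i})"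
        using i(1) by (auto simp: Y_def Vj)
    qed
  qed
  \<comment> \<open>The statement just proved always yields some \<open>i < N\<close>, so
    \<open>N\<close> cannot be 0.\<close>
  have "N > 0" using main[of "\<lambda>_ _. e0"] e0 by fastforce
  moreover have "n > 0" by (simp add: n_def)
  ultimately show ?thesis
    using main by (intro exI[of _ n] exI[of _ N] conjI allI impI) simp_all
qed

section \<open>Expressing the shattering of finite grids\<close>

definition lookup :: "'b list \<Rightarrow> 'c list \<Rightarrow> 'b \<Rightarrow> 'c" where
  "lookup vs as v = the (map_of (zip vs as) v)"

lemma map_lookup:
  assumes "distinct vs" "length as = length vs"
  shows "map (lookup vs as) vs = as"
proof (rule nth_equalityI)
  fix i assume "i < length (map (lookup vs as) vs)"
  then show "map (lookup vs as) vs ! i = as ! i"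
    using assms by (simp add: lookup_def map_of_zip_nth)
qed (simp add: assms)

lemma length_tuples: "as \<in> tuples M vs \<Longrightarrow> length as = length vs"
  by (auto simp: tuples_def sort_tuples_def dest: list_all2_lengthD)

lemma lookup_in_carrier:
  assumes "distinct vs" "as \<in> tuples M vs" "v \<in> set vs"
  shows "lookup vs as v \<in> carrier M (var_sort v)"
proof -
  have "map (lookup vs as) vs \<in> tuples M vs"
    using assms by (simp add: map_lookup length_tuples)
  then show ?thesis using assms(3) by (simp add: map_in_tuples_iff)
qed

text \<open>Copies of \<open>y2\<close> carry the row number only and copies of \<open>y3\<close>
  the column number only, so cells of one row share their \<open>y2\<close>-tuple and cells of one
  column their \<open>y3\<close>-tuple.\<close>

definition grid_copy :: "nat \<Rightarrow> 's var list \<Rightarrow> nat \<times> nat \<Rightarrow> 's var \<Rightarrow> 's var" where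
  "grid_copy K y2 ij v = copy K (if v \<in> set y2 then fst ij else snd ij) v"

text \<open>The sentence that carries shattering of a finite grid from one model to another. Shared
  copies occur repeatedly in the quantified list, which \<open>Exs\<close> tolerates.\<close>

definition grid_fm ::
    "nat \<Rightarrow> nat \<Rightarrow> nat \<Rightarrow> 's var list \<Rightarrow> 's var list \<Rightarrow> 's var list \<Rightarrow> ('f, 'r, 's) fm \<Rightarrow>
     ('f, 'r, 's) fm" where
  "grid_fm K N n y1 y2 y3 p =
     (let J = List.product [0..<N] [0..<n] in
      Exs (concat (map (\<lambda>ij. map (grid_copy K y2 ij) (y2 @ y3)) J))
        (Conjs (map (\<lambda>T. pattern_fm y1 (y2 @ y3) (grid_copy K y2) J p (set T)) (subseqs J))))"

definition cell ::
    "nat \<Rightarrow> 's var list \<Rightarrow> 's var list \<Rightarrow> ('s var \<Rightarrow> 'a) \<Rightarrow> ('s var \<Rightarrow> 'a) \<Rightarrow> nat \<Rightarrow> nat \<Rightarrow> 's var \<Rightarrow> 'a"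
  where
  "cell K y1 y2 e1 e2 i j v = (if v \<in> set y1 then e2 v else e1 (grid_copy K y2 (i, j) v))"

definition shatters_grid ::
    "('f, 'r, 's, 'a) struct \<Rightarrow> nat \<Rightarrow> nat \<Rightarrow> nat \<Rightarrow> 's var list \<Rightarrow> 's var list \<Rightarrow> 's var list \<Rightarrow>
     ('f, 'r, 's) fm \<Rightarrow> bool" where
  "shatters_grid M K N n y1 y2 y3 p \<longleftrightarrow>
     (\<exists>e1. (\<forall>i<N. \<forall>j<n. \<forall>v\<in>set (y2 @ y3).
          e1 (grid_copy K y2 (i, j) v) \<in> carrier M (var_sort v)) \<and>
       (\<forall>T \<subseteq> {..<N} \<times> {..<n}. \<exists>e2. (\<forall>v\<in>set y1. e2 v \<in> carrier M (var_sort v)) \<and>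
          (\<forall>i<N. \<forall>j<n. sat M (cell K y1 y2 e1 e2 i j) p \<longleftrightarrow> (i, j) \<in> T)))"

lemma subseqs_nonempty: "subseqs xs \<noteq> []"
  using subseqs_powset[of xs] by auto

lemma product_upt_nonempty: "n > 0 \<Longrightarrow> N > 0 \<Longrightarrow> List.product [0..<N] [0..<n] \<noteq> []"
  by (metis length_0_conv length_product length_upt mult_is_0 diff_zero not_gr0)

lemma grid_fm_sentence:
  assumes "n > 0" "N > 0" "is_formula L p" "fv p \<subseteq> set (y1 @ y2 @ y3)"
    "set (y1 @ y2 @ y3) \<subseteq> vars L"
  shows "is_formula L (grid_fm K N n y1 y2 y3 p)" "fv (grid_fm K N n y1 y2 y3 p) = {}"
proof -
  let ?J = "List.product [0..<N] [0..<n]"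
  let ?p = "\<lambda>T. pattern_fm y1 (y2 @ y3) (grid_copy K y2) ?J p (set T)"
  have J: "?J \<noteq> []" using assms(1,2) by (rule product_upt_nonempty)
  have ne: "map ?p (subseqs ?J) \<noteq> []" using subseqs_nonempty by simp
  have "is_formula L (?p T)" for T
    using assms J by (intro is_formula_pattern_fm) (auto simp: grid_copy_def)
  then have "is_formula L (Conjs (map ?p (subseqs ?J)))"
    using is_formula_Conjs[OF ne, of L] by simp
  moreover have "set (concat (map (\<lambda>ij. map (grid_copy K y2 ij) (y2 @ y3)) ?J)) \<subseteq> vars L"
    using assms(5) by (auto simp: grid_copy_def)
  ultimately show "is_formula L (grid_fm K N n y1 y2 y3 p)"
    by (simp add: grid_fm_def Let_def is_formula_Exs)
  have "fv (?p T) \<subseteq> (\<Union>ij\<in>set ?J. grid_copy K y2 ij ` set (y2 @ y3))" for T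
    using fv_pattern_fm[OF J, of y1 "y2 @ y3" "grid_copy K y2" p "set T"] assms(4) by auto
  then have "fv (Conjs (map ?p (subseqs ?J))) \<subseteq>
      (\<Union>ij\<in>set ?J. grid_copy K y2 ij ` set (y2 @ y3))"
    unfolding fv_Conjs[OF ne] by (simp add: UN_subset_iff)
  then show "fv (grid_fm K N n y1 y2 y3 p) = {}"
    by (simp add: grid_fm_def Let_def fv_Exs image_Un)
qed

lemma sat_grid_fm:
  assumes nN: "n > 0" "N > 0" and p: "fv p \<subseteq> set (y1 @ y2 @ y3)"
    and dist: "distinct (y1 @ y2 @ y3)" and K: "\<And>j v. copy K j v \<notin> set (y1 @ y2 @ y3)"
  shows "sat M e (grid_fm K N n y1 y2 y3 p) \<longleftrightarrow> shatters_grid M K N n y1 y2 y3 p"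
proof -
  let ?J = "List.product [0..<N] [0..<n]"
  let ?p = "\<lambda>T. pattern_fm y1 (y2 @ y3) (grid_copy K y2) ?J p T"
  let ?W = "concat (map (\<lambda>ij. map (grid_copy K y2 ij) (y2 @ y3)) ?J)"
  have J: "?J \<noteq> []" using nN by (rule product_upt_nonempty)
  have set_J: "set ?J = {..<N} \<times> {..<n}" by (auto simp: atLeast0LessThan)
  have ne: "map (\<lambda>T. ?p (set T)) (subseqs ?J) \<noteq> []" using subseqs_nonempty by simp
  have sort: "var_sort (grid_copy K y2 ij v) = var_sort v" for ij v
    by (simp add: grid_copy_def)
  have ball_grid: "(\<forall>ij\<in>{..<N} \<times> {..<n}. P ij) \<longleftrightarrow> (\<forall>i<N. \<forall>j<n. P (i, j))" for P
    by auto
  have W: "(\<forall>v\<in>set ?W. e1 v \<in> carrier M (var_sort v)) \<longleftrightarrow>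
      (\<forall>i<N. \<forall>j<n. \<forall>v\<in>set (y2 @ y3). e1 (grid_copy K y2 (i, j) v) \<in> carrier M (var_sort v))"
    for e1
  proof -
    have "(\<forall>v\<in>set ?W. e1 v \<in> carrier M (var_sort v)) \<longleftrightarrow> (\<forall>ij\<in>{..<N} \<times> {..<n}.
        \<forall>v\<in>set (y2 @ y3). e1 (grid_copy K y2 ij v) \<in> carrier M (var_sort (grid_copy K y2 ij v)))"
      by (simp only: set_concat set_map ball_UN ball_simps set_J)
    then show ?thesis by (simp only: ball_grid sort)
  qed
  have pat: "sat M (override_on e e1 (set ?W)) (?p T) \<longleftrightarrow>
      (\<exists>e2. (\<forall>v\<in>set y1. e2 v \<in> carrier M (var_sort v)) \<and>
        (\<forall>i<N. \<forall>j<n. sat M (cell K y1 y2 e1 e2 i j) p \<longleftrightarrow> (i, j) \<in> T))"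
    if e1: "\<forall>v\<in>set ?W. e1 v \<in> carrier M (var_sort v)" for e1 T
  proof -
    let ?e = "override_on e e1 (set ?W)"
    have in_W: "grid_copy K y2 ij v \<in> set ?W" if "ij \<in> set ?J" "v \<in> set (y2 @ y3)" for ij v
      using that by fastforce
    have sat_p: "sat M ?e (?p T) \<longleftrightarrow> (\<exists>e2. (\<forall>v\<in>set y1. e2 v \<in> carrier M (var_sort v)) \<and>
        (\<forall>ij\<in>set ?J. sat M (override_on (override_on ?e (?e \<circ> grid_copy K y2 ij) (set (y2 @ y3)))
          e2 (set y1)) p \<longleftrightarrow> ij \<in> T))"
    proof (rule sat_pattern_fm[OF J])
      show "set y1 \<inter> set (y2 @ y3) = {}" using dist by auto
      fix ij v assume ij: "ij \<in> set ?J" "v \<in> set (y2 @ y3)"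
      have "?e (grid_copy K y2 ij v) \<in> carrier M (var_sort (grid_copy K y2 ij v))"
        using bspec[OF e1 in_W[OF ij]] override_on_apply_in[OF in_W[OF ij], of e e1]
        by (simp only:)
      moreover have "grid_copy K y2 ij v \<notin> set y1 \<union> set (y2 @ y3)"
        using K[of _ v] by (simp add: grid_copy_def)
      ultimately show "grid_copy K y2 ij v \<notin> set y1 \<union> set (y2 @ y3) \<and>
          ?e (grid_copy K y2 ij v) \<in> carrier M (var_sort v)"
        by (simp only: sort) simp
    qed
    have sat_cell: "sat M (override_on (override_on ?e (?e \<circ> grid_copy K y2 ij) (set (y2 @ y3)))
          e2 (set y1)) p \<longleftrightarrow> sat M (cell K y1 y2 e1 e2 (fst ij) (snd ij)) p"
      if ij: "ij \<in> set ?J" for ij e2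
    proof (rule sat_cong)
      fix v assume "v \<in> fv p"
      then have v: "v \<in> set y1 \<or> v \<in> set (y2 @ y3)" using p by auto
      show "override_on (override_on ?e (?e \<circ> grid_copy K y2 ij) (set (y2 @ y3))) e2 (set y1) v =
          cell K y1 y2 e1 e2 (fst ij) (snd ij) v"
      proof (cases "v \<in> set y1")
        case True
        then show ?thesis by (simp add: cell_def)
      next
        case False
        then have "v \<in> set (y2 @ y3)" using v by blast
        then have "?e (grid_copy K y2 ij v) = e1 (grid_copy K y2 ij v)"
          using in_W[OF ij] by (intro override_on_apply_in)
        then show ?thesis
          using False \<open>v \<in> set (y2 @ y3)\<close> by (simp only: cell_def comp_def prod.collapse
              override_on_apply_in override_on_apply_notin if_False simp_thms)
      qed
    qed
    have "(\<forall>ij\<in>set ?J. sat M (override_on (override_on ?e (?e \<circ> grid_copy K y2 ij) (set (y2 @ y3)))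
          e2 (set y1)) p \<longleftrightarrow> ij \<in> T) \<longleftrightarrow>
        (\<forall>ij\<in>set ?J. sat M (cell K y1 y2 e1 e2 (fst ij) (snd ij)) p \<longleftrightarrow> ij \<in> T)" for e2
      by (rule ball_cong[OF refl]) (simp only: sat_cell)
    then show ?thesis using sat_p by (simp only: set_J ball_grid fst_conv snd_conv)
  qed
  have "sat M e (grid_fm K N n y1 y2 y3 p) \<longleftrightarrow>
      (\<exists>e1. (\<forall>v\<in>set ?W. e1 v \<in> carrier M (var_sort v)) \<and>
        (\<forall>T\<in>set ` set (subseqs ?J). sat M (override_on e e1 (set ?W)) (?p T)))"
    unfolding grid_fm_def Let_def sat_Exs sat_Conjs[OF ne] by simp
  also have "\<dots> \<longleftrightarrow> (\<exists>e1. (\<forall>v\<in>set ?W. e1 v \<in> carrier M (var_sort v)) \<and>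
      (\<forall>T\<in>set ` set (subseqs ?J). \<exists>e2. (\<forall>v\<in>set y1. e2 v \<in> carrier M (var_sort v)) \<and>
        (\<forall>i<N. \<forall>j<n. sat M (cell K y1 y2 e1 e2 i j) p \<longleftrightarrow> (i, j) \<in> T)))"
    by (intro ex_cong1 conj_cong ball_cong refl pat)
  also have "\<dots> \<longleftrightarrow> shatters_grid M K N n y1 y2 y3 p"
    unfolding shatters_grid_def subseqs_powset set_J W by (simp only: Ball_def Pow_iff)
  finally show ?thesis .
qed

text \<open>Restricts an infinite shattered grid to a finite corner.\<close>

lemma shatters_in_shatters_grid:
  assumes sh: "shatters_in M p y1 [y2, y3]" and p: "fv p \<subseteq> set (y1 @ y2 @ y3)"
    and dist: "distinct (y1 @ y2 @ y3)"
  shows "shatters_grid M K N n y1 y2 y3 p"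
proof -
  obtain a where a: "\<forall>j<length [y2, y3]. \<forall>i. a j i \<in> tuples M ([y2, y3] ! j)"
    and a': "\<forall>S \<subseteq> {I :: nat list. length I = length [y2, y3]}.
       \<exists>b\<in>tuples M y1. \<forall>I. length I = length [y2, y3] \<longrightarrow>
         (sat_at M p (y1 @ concat [y2, y3])
             (b @ concat (map (\<lambda>j. a j (I ! j)) [0..<length [y2, y3]])) \<longleftrightarrow> I \<in> S)"
    using sh unfolding shatters_in_def by (elim exE conjE)
  have a2: "a 0 i \<in> tuples M y2" and a3: "a 1 i \<in> tuples M y3" for i
    using a[rule_format, of 0 i] a[rule_format, of 1 i] by simp_all
  have len: "length (a 0 i) = length y2" "length (a 1 i) = length y3" for i
    using length_tuples[OF a2] length_tuples[OF a3] by simp_all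
  \<comment> \<open>A copied variable is decoded into its number and its original, which select the
    tuple and the entry to return.\<close>
  define e1 where "e1 z = (let v = copied_var K z; i = copy_index K z in
      if v \<in> set y2 then lookup y2 (a 0 i) v else lookup y3 (a 1 i) v)" for z
  have e1: "e1 (grid_copy K y2 (i, j) v) =
      (if v \<in> set y2 then lookup y2 (a 0 i) v else lookup y3 (a 1 j) v)" for i j v
    by (simp add: e1_def grid_copy_def)
  have "\<exists>e2. (\<forall>v\<in>set y1. e2 v \<in> carrier M (var_sort v)) \<and>
      (\<forall>i<N. \<forall>j<n. sat M (cell K y1 y2 e1 e2 i j) p \<longleftrightarrow> (i, j) \<in> T)" for T
  proof -
    have "{[i, j] | i j. (i, j) \<in> T} \<subseteq> {I. length I = length [y2, y3]}" by auto
    from a'[THEN spec, THEN mp, OF this]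
    obtain b where b: "b \<in> tuples M y1" and b': "\<forall>I. length I = length [y2, y3] \<longrightarrow>
        (sat_at M p (y1 @ concat [y2, y3])
          (b @ concat (map (\<lambda>j. a j (I ! j)) [0..<length [y2, y3]])) \<longleftrightarrow>
        I \<in> {[i, j] | i j. (i, j) \<in> T})"
      by (elim bexE)
    have "sat M (cell K y1 y2 e1 (lookup y1 b) i j) p \<longleftrightarrow> (i, j) \<in> T" for i j
    proof -
      let ?c = "cell K y1 y2 e1 (lookup y1 b) i j"
      have "map ?c y1 = map (lookup y1 b) y1" by (simp add: cell_def)
      also have "\<dots> = b" using length_tuples[OF b] dist by (intro map_lookup) simp_all
      finally have 1: "map ?c y1 = b" .
      have "map ?c y2 = map (lookup y2 (a 0 i)) y2"
        using dist by (auto simp: cell_def e1)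
      also have "\<dots> = a 0 i" using len dist by (intro map_lookup) simp_all
      finally have 2: "map ?c y2 = a 0 i" .
      have "map ?c y3 = map (lookup y3 (a 1 j)) y3"
        using dist by (auto simp: cell_def e1)
      also have "\<dots> = a 1 j" using len dist by (intro map_lookup) simp_all
      finally have 3: "map ?c y3 = a 1 j" .
      have "sat M ?c p \<longleftrightarrow> sat_at M p (y1 @ y2 @ y3) (map ?c (y1 @ y2 @ y3))"
        using dist p by (rule sat_at_iff[symmetric])
      also have "\<dots> \<longleftrightarrow> [i, j] \<in> {[i, j] | i j. (i, j) \<in> T}"
        using b'[rule_format, of "[i, j]"] by (simp add: 1 2 3)
      finally show ?thesis by simp
    qed
    moreover have "\<forall>v\<in>set y1. lookup y1 b v \<in> carrier M (var_sort v)"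
      using b dist by (auto intro: lookup_in_carrier)
    ultimately show ?thesis by blast
  qed
  moreover have "\<forall>i<N. \<forall>j<n. \<forall>v\<in>set (y2 @ y3).
      e1 (grid_copy K y2 (i, j) v) \<in> carrier M (var_sort v)"
    using a2 a3 dist by (auto simp: e1 intro: lookup_in_carrier)
  ultimately show ?thesis unfolding shatters_grid_def by blast
qed

text \<open>The theory of a structure is complete: a sentence failing in \<open>M\<close> has its
  negation in \<open>Th L M\<close>.\<close>

lemma Th_complete:
  assumes "is_model L (Th L M) N" "is_formula L p" "fv p = {}" "\<And>e. sat N e p"
  shows "sat M e p"
proof (rule ccontr)
  assume "\<not> sat M e p"
  then have "\<not> sat M e' p" for e' using sat_cong[of p e e' M] assms(3) by simp
  then have "Neg p \<in> Th L M" using assms(2,3) by (simp add: Th_def)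
  then have "sat N undefined (Neg p)" using assms(1) unfolding is_model_def by blast
  then show False using assms(4) by simp
qed

section \<open>Composition with binary functions\<close>

text \<open>Dependence of \<open>M0\<close> is not part of the context; it enters as bounds
  \<open>vc_bound\<close> when a grid is chosen.\<close>

locale binary_composition =
  fixes L0 L :: "('f, 'r, 's) language"
    and M0 M :: "('f, 'r, 's, 'a) struct"
    and \<phi> :: "('f, 'r, 's) fm"
    and d :: nat
    and x y :: "nat \<Rightarrow> 's var list"
    and s t :: "nat \<Rightarrow> nat"
    and f :: "nat \<Rightarrow> 'a list \<Rightarrow> 'a list \<Rightarrow> 'a list"
  assumes expansion: "expansion L0 M0 L M"
    and \<phi>: "is_formula L0 \<phi>" "fv \<phi> \<subseteq> set (concat (map x [1..<Suc d]))"
    and x_vars: "\<And>i. i \<in> {1..d} \<Longrightarrow> set (x i) \<subseteq> vars L0"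
    and y_vars: "\<And>j. j \<in> {1, 2, 3} \<Longrightarrow> set (y j) \<subseteq> vars L"
    and dist: "distinct (concat (map x [1..<Suc d]) @ y 1 @ y 2 @ y 3)"
    and st: "\<And>i. i \<in> {1..d} \<Longrightarrow> s i \<in> {1, 2, 3} \<and> t i \<in> {1, 2, 3} \<and> s i < t i"
    and definable: "\<And>i. i \<in> {1..d} \<Longrightarrow> definable_fun2 L M (y (s i)) (y (t i)) (x i) (f i)"
begin

declare upt_Suc [simp del]

abbreviation "xs \<equiv> concat (map x [1..<Suc d])"
abbreviation "ys \<equiv> y 1 @ y 2 @ y 3"
abbreviation "R \<equiv> composite_relation M d \<phi> x y s t f"

definition block :: "'s var \<Rightarrow> nat" where
  "block v = (THE i. i \<in> {1..d} \<and> v \<in> set (x i))"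

definition args :: "('s var \<Rightarrow> 'a) \<Rightarrow> nat \<Rightarrow> 'a list" where
  "args e i = f i (map e (y (s i))) (map e (y (t i)))"

text \<open>The assignment to the variables \<open>x i\<close> under which \<open>\<phi>\<close>
  says what the composite says under \<open>e\<close>.\<close>

definition fval :: "('s var \<Rightarrow> 'a) \<Rightarrow> 's var \<Rightarrow> 'a" where
  "fval e v = lookup (x (block v)) (args e (block v)) v"

lemma set_upt_d: "set [1..<Suc d] = {1..d}"
  by auto

lemma set_xs: "set xs = (\<Union>i\<in>{1..d}. set (x i))"
  by (simp only: set_concat set_map set_upt_d image_image)

lemma sublanguage: "sublanguage L0 L" and struct: "is_struct L0 M0" "is_struct L M"
  and carrier_eq: "s' \<in> sorts L0 \<Longrightarrow> carrier M s' = carrier M0 s'"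
  using expansion by (simp_all add: expansion_def)

lemma vars_L0_L: "v \<in> vars L0 \<Longrightarrow> v \<in> vars L"
  using sublanguage by (auto simp: sublanguage_def vars_def)

lemma xs_vars: "set xs \<subseteq> vars L0"
  unfolding set_xs using x_vars by blast

lemma ys_vars: "set ys \<subseteq> vars L"
  using y_vars by simp

lemma distinct_xs: "distinct xs" and distinct_ys: "distinct ys" and xs_ys: "set xs \<inter> set ys = {}"
  using dist by (simp_all only: distinct_append)

lemma distinct_x:
  assumes "i \<in> {1..d}"
  shows "distinct (x i)"
proof -
  have "x i \<in> set (map x [1..<Suc d])" using assms by (simp only: set_map set_upt_d imageI)
  then show ?thesis using distinct_xs by (simp only: distinct_concat_iff)
qed

lemma block_eq:
  assumes "i \<in> {1..d}" "v \<in> set (x i)"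
  shows "block v = i"
  unfolding block_def
proof (rule the_equality)
  fix i' assume i': "i' \<in> {1..d} \<and> v \<in> set (x i')"
  show "i' = i"
  proof (rule ccontr)
    assume "i' \<noteq> i"
    define a where "a = min i i'"
    define b where "b = max i i'"
    have ab: "1 \<le> a" "a < b" "b \<le> d" "v \<in> set (x a)" "v \<in> set (x b)"
      using assms i' \<open>i' \<noteq> i\<close> by (auto simp: a_def b_def min_def max_def)
    \<comment> \<open>Cutting at the larger index puts the two occurrences of \<open>v\<close> into
      different parts of a distinct list.\<close>
    then have "[1..<Suc d] = [1..<b] @ [b..<Suc d]"
      using upt_add_eq_append[of 1 b "Suc d - b"] by simp
    then have "set (concat (map x [1..<b])) \<inter> set (concat (map x [b..<Suc d])) = {}"
      using distinct_xs by (simp only: map_append concat_append distinct_append)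
    moreover have "v \<in> (\<Union>i\<in>{1..<b}. set (x i))" "v \<in> (\<Union>i\<in>{b..<Suc d}. set (x i))"
      using ab by auto
    ultimately show False by (simp only: set_concat set_map set_upt image_image) blast
  qed
qed (use assms in simp)

lemma args_in_tuples:
  assumes e: "e \<in> assignments L M" and i: "i \<in> {1..d}"
  shows "args e i \<in> tuples M (x i)"
proof -
  have "map e (y (s i)) \<in> tuples M (y (s i))" "map e (y (t i)) \<in> tuples M (y (t i))"
    using e st[OF i] y_vars by (auto simp: map_in_tuples_iff assignments_def)
  then show ?thesis using definable[OF i] by (simp add: definable_fun2_def args_def)
qed

lemma map_fval:
  assumes e: "e \<in> assignments L M" and i: "i \<in> {1..d}"
  shows "map (fval e) (x i) = args e i"
proof -
  have "map (fval e) (x i) = map (lookup (x i) (args e i)) (x i)"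
    using block_eq[OF i] by (simp add: fval_def)
  also have "\<dots> = args e i"
    using distinct_x[OF i] length_tuples[OF args_in_tuples[OF e i]] by (rule map_lookup)
  finally show ?thesis .
qed

lemma fval_in_carrier:
  assumes e: "e \<in> assignments L M" and v: "v \<in> set xs"
  shows "fval e v \<in> carrier M0 (var_sort v)"
proof -
  obtain i where i: "i \<in> {1..d}" "v \<in> set (x i)" using v unfolding set_xs by (rule UN_E)
  have "map (fval e) (x i) \<in> tuples M (x i)"
    using args_in_tuples[OF e i(1)] map_fval[OF e i(1)] by simp
  then have "fval e v \<in> carrier M (var_sort v)" using i(2) by (simp add: map_in_tuples_iff)
  moreover have "var_sort v \<in> sorts L0" using x_vars[OF i(1)] i(2) by (auto simp: vars_def)
  ultimately show ?thesis by (simp add: carrier_eq)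
qed

text \<open>The place where binarity is exploited: each value depends on two of the three tuples
  only.\<close>

lemma fval_cong:
  assumes "v \<in> set xs"
    and "\<And>w. w \<in> set (y (s (block v))) \<union> set (y (t (block v))) \<Longrightarrow> e w = e' w"
  shows "fval e v = fval e' v"
proof -
  have "map e (y (s (block v))) = map e' (y (s (block v)))"
    "map e (y (t (block v))) = map e' (y (t (block v)))"
    using assms(2) by auto
  then show ?thesis by (simp only: fval_def args_def)
qed

lemma mem_R_iff:
  assumes e: "e \<in> assignments L M"
  shows "map e ys \<in> R \<longleftrightarrow> sat M (fval e) \<phi>"
proof -
  have vals: "concat (map (args e) [1..<Suc d]) = map (fval e) xs"
  proof -
    have "map (args e) [1..<Suc d] = map (map (fval e)) (map x [1..<Suc d])"
      unfolding map_map
      by (rule map_cong[OF refl]) (simp only: set_upt_d comp_apply map_fval[OF e])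
    then show ?thesis by (simp only: map_concat)
  qed
  have "map e ys \<in> R \<longleftrightarrow> sat_at M \<phi> xs (concat (map (args e) [1..<Suc d]))" (is "?l \<longleftrightarrow> ?r")
  proof
    assume ?l
    then obtain a where a: "map e ys = a 1 @ a 2 @ a 3" "\<forall>j\<in>{1, 2, 3}. a j \<in> tuples M (y j)"
      and sat: "sat_at M \<phi> xs (concat (map (\<lambda>i. f i (a (s i)) (a (t i))) [1..<Suc d]))"
      unfolding composite_relation_def by blast
    \<comment> \<open>The lengths make the decomposition of the concatenated tuple unique.\<close>
    have "length (a 1) = length (y 1)" "length (a 2) = length (y 2)"
      using a(2) length_tuples by blast+
    then have "a 1 = map e (y 1)" "a 2 = map e (y 2)" "a 3 = map e (y 3)"
      using a(1) by (simp_all add: append_eq_append_conv)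
    then have aj: "a j = map e (y j)" if "j \<in> {1, 2, 3}" for j using that by auto
    have "map (\<lambda>i. f i (a (s i)) (a (t i))) [1..<Suc d] = map (args e) [1..<Suc d]"
    proof (rule map_cong[OF refl])
      fix i assume "i \<in> set [1..<Suc d]"
      then have "i \<in> {1..d}" by (simp only: set_upt_d)
      from st[OF this] show "f i (a (s i)) (a (t i)) = args e i"
        using aj[of "s i"] aj[of "t i"] by (simp only: args_def)
    qed
    then show ?r using sat by (simp only:)
  next
    assume r: ?r
    have "\<forall>j\<in>{1, 2, 3}. map e (y j) \<in> tuples M (y j)"
      using e y_vars by (auto simp: map_in_tuples_iff assignments_def)
    then show ?l
      unfolding composite_relation_def using r
      by (intro CollectI exI[of _ "\<lambda>j. map e (y j)"]) (simp add: args_def[abs_def])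
  qed
  also have "\<dots> \<longleftrightarrow> sat M (fval e) \<phi>"
    unfolding vals by (rule sat_at_iff[OF distinct_xs \<phi>(2)])
  finally show ?thesis .
qed

lemma ex_assignment_of_tuple:
  assumes "as \<in> tuples M ys"
  obtains e where "e \<in> assignments L M" "as = map e ys"
proof -
  obtain e0 where e0: "e0 \<in> assignments L M" using assignments_nonempty[OF struct(2)] by (rule exE)
  let ?e = "override_on e0 (lookup ys as) (set ys)"
  have "?e \<in> assignments L M"
    using e0 by (rule assignments_override_on) (rule lookup_in_carrier[OF distinct_ys assms])
  moreover have "as = map ?e ys"
  proof -
    have "map ?e ys = map (lookup ys as) ys" by (rule map_cong) simp_all
    then show ?thesis using map_lookup[OF distinct_ys length_tuples[OF assms]] by (simp only:)
  qed
  ultimately show thesis by (rule that)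
qed

lemma defines_R_iff:
  assumes "defines_rel L M \<psi> ys R" "e \<in> assignments L M"
  shows "sat M e \<psi> \<longleftrightarrow> sat M (fval e) \<phi>"
proof -
  have "map e ys \<in> tuples M ys"
    unfolding map_in_tuples_iff using assms(2) ys_vars by (auto simp: assignments_def)
  then have "sat_at M \<psi> ys (map e ys) \<longleftrightarrow> map e ys \<in> R"
    using assms(1) unfolding defines_rel_def by (elim conjE bspec)
  moreover have "fv \<psi> \<subseteq> set ys" using assms(1) unfolding defines_rel_def by (elim conjE)
  note sat_at_iff[OF distinct_ys this, of M e]
  ultimately show ?thesis using mem_R_iff[OF assms(2)] by (simp only:)
qed

lemma ex_defining_formula: "\<exists>\<psi>. defines_rel L M \<psi> ys R"
proof -
  let ?G = "\<lambda>i. {a @ b @ f i a b | a b. a \<in> tuples M (y (s i)) \<and> b \<in> tuples M (y (t i))}"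
  have "\<forall>i. \<exists>p. i \<in> {1..d} \<longrightarrow> defines_rel L M p (y (s i) @ y (t i) @ x i) (?G i)"
    using definable unfolding definable_fun2_def by simp
  from choice[OF this] obtain P where P:
    "\<forall>i. i \<in> {1..d} \<longrightarrow> defines_rel L M (P i) (y (s i) @ y (t i) @ x i) (?G i)"
    by (rule exE)
  have Pd: "is_formula L (P i)" "fv (P i) \<subseteq> set (y (s i) @ y (t i) @ x i)"
    "\<forall>as\<in>tuples M (y (s i) @ y (t i) @ x i).
       sat_at M (P i) (y (s i) @ y (t i) @ x i) as \<longleftrightarrow> as \<in> ?G i"
    if "i \<in> {1..d}" for i
    using P[rule_format, OF that] unfolding defines_rel_def by simp_all
  have y_sub: "set (y (s i)) \<subseteq> set ys" "set (y (t i)) \<subseteq> set ys" if "i \<in> {1..d}" for i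
    using st[OF that] by auto
  \<comment> \<open>The formula asserts that some values of the \<open>x i\<close> lie on the graphs
    of the functions and satisfy \<open>\<phi>\<close>; the graphs force these values to be
    \<open>fval e\<close>.\<close>
  define \<psi> where "\<psi> = Exs xs (foldr And (map P [1..<Suc d]) \<phi>)"
  have form: "is_formula L \<psi>"
    using Pd(1) is_formula_sublanguage[OF sublanguage \<phi>(1)] xs_vars vars_L0_L
    unfolding \<psi>_def is_formula_Exs is_formula_foldr_And set_map set_upt_d by blast
  have fv: "fv \<psi> \<subseteq> set ys"
  proof
    fix v assume "v \<in> fv \<psi>"
    then have v: "v \<notin> set xs" "v \<in> fv \<phi> \<union> (\<Union>i\<in>{1..d}. fv (P i))"
      unfolding \<psi>_def fv_Exs fv_foldr_And set_map set_upt_d by auto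
    then obtain i where i: "i \<in> {1..d}" "v \<in> fv (P i)" using \<phi>(2) by blast
    then have "v \<in> set (y (s i)) \<union> set (y (t i)) \<union> set (x i)" using Pd(2)[OF i(1)] by auto
    moreover have "v \<notin> set (x i)" using v(1) i(1) unfolding set_xs by blast
    ultimately show "v \<in> set ys" using y_sub[OF i(1)] by blast
  qed
  have sat_P: "sat M (override_on e e' (set xs)) (P i) \<longleftrightarrow> (\<forall>v\<in>set (x i). e' v = fval e v)"
    if e: "e \<in> assignments L M" and e': "\<forall>v\<in>set xs. e' v \<in> carrier M (var_sort v)"
      and i: "i \<in> {1..d}" for e e' i
  proof -
    let ?e = "override_on e e' (set xs)"
    have x_sub: "set (x i) \<subseteq> set xs" unfolding set_xs using i by blast
    have "?e \<in> assignments L M" using e by (rule assignments_override_on) (rule bspec[OF e'])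
    then have in_carrier: "?e v \<in> carrier M (var_sort v)" if "v \<in> vars L" for v
      using that by (simp add: assignments_def)
    have tup: "map ?e (y (s i)) \<in> tuples M (y (s i))" "map ?e (y (t i)) \<in> tuples M (y (t i))"
      "map ?e (x i) \<in> tuples M (x i)"
      unfolding map_in_tuples_iff
      using in_carrier y_sub[OF i] ys_vars x_sub xs_vars vars_L0_L by blast+
    have y_eq: "map ?e (y (s i)) = map e (y (s i))" "map ?e (y (t i)) = map e (y (t i))"
      using y_sub[OF i] xs_ys by (auto simp: override_on_def)
    have x_eq: "map ?e (x i) = map e' (x i)" using x_sub by (auto simp: override_on_def)
    have vs: "map ?e (y (s i) @ y (t i) @ x i) \<in> tuples M (y (s i) @ y (t i) @ x i)"
      using tup unfolding map_in_tuples_iff set_append by blast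
    have dist_i: "distinct (y (s i) @ y (t i) @ x i)"
    proof -
      have "set (y (s i)) \<inter> set (y (t i)) = {}" "distinct (y (s i))" "distinct (y (t i))"
        using st[OF i] dist by auto
      moreover have "(set (y (s i)) \<union> set (y (t i))) \<inter> set (x i) = {}"
        using y_sub[OF i] x_sub xs_ys by blast
      ultimately show ?thesis using distinct_x[OF i] by auto
    qed
    have "sat M ?e (P i) \<longleftrightarrow> map ?e (y (s i) @ y (t i) @ x i) \<in> ?G i"
      using sat_at_iff[OF dist_i Pd(2)[OF i], of M ?e] bspec[OF Pd(3)[OF i] vs] by (simp only:)
    also have "\<dots> \<longleftrightarrow> map ?e (x i) = f i (map ?e (y (s i))) (map ?e (y (t i)))"
      (is "?l \<longleftrightarrow> ?r")
    proof
      assume ?l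
      then obtain a b where ab: "map ?e (y (s i) @ y (t i) @ x i) = a @ b @ f i a b"
        "a \<in> tuples M (y (s i))" "b \<in> tuples M (y (t i))"
        by (elim CollectE exE conjE)
      then show ?r
        using length_tuples[OF ab(2)] length_tuples[OF ab(3)] by (simp add: append_eq_append_conv)
    next
      assume ?r
      then show ?l using tup by (intro CollectI exI conjI) simp_all
    qed
    also have "\<dots> \<longleftrightarrow> map e' (x i) = map (fval e) (x i)"
      unfolding x_eq y_eq map_fval[OF e i] args_def ..
    also have "\<dots> \<longleftrightarrow> (\<forall>v\<in>set (x i). e' v = fval e v)" by (rule map_eq_conv)
    finally show ?thesis .
  qed
  have "sat_at M \<psi> ys as \<longleftrightarrow> as \<in> R" if as: "as \<in> tuples M ys" for as
  proof -
    obtain e where e: "e \<in> assignments L M" "as = map e ys" using ex_assignment_of_tuple[OF as] .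
      have phi: "sat M (override_on e e' (set xs)) \<phi> \<longleftrightarrow> sat M e' \<phi>" for e'
      using \<phi>(2) by (intro sat_cong) (auto simp: override_on_def)
    have "sat M e \<psi> \<longleftrightarrow> (\<exists>e'. (\<forall>v\<in>set xs. e' v \<in> carrier M (var_sort v)) \<and>
        sat M e' \<phi> \<and> (\<forall>i\<in>{1..d}. sat M (override_on e e' (set xs)) (P i)))"
      unfolding \<psi>_def sat_Exs sat_foldr_And set_map set_upt_d phi by simp
    also have "\<dots> \<longleftrightarrow> (\<exists>e'. (\<forall>v\<in>set xs. e' v \<in> carrier M (var_sort v)) \<and>
        sat M e' \<phi> \<and> (\<forall>v\<in>set xs. e' v = fval e v))"
      unfolding set_xs using sat_P[OF e(1)] unfolding set_xs by (simp cong: conj_cong)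
    also have "\<dots> \<longleftrightarrow> sat M (fval e) \<phi>" (is "?l \<longleftrightarrow> ?r")
    proof
      assume ?l
      then obtain e' where "sat M e' \<phi>" "\<forall>v\<in>set xs. e' v = fval e v" by (elim exE conjE)
      then show ?r using sat_cong[of \<phi> e' "fval e" M] \<phi>(2) by blast
    next
      assume ?r
      moreover have "fval e v \<in> carrier M (var_sort v)" if "v \<in> set xs" for v
        using fval_in_carrier[OF e(1) that] xs_vars that carrier_eq[of "var_sort v"]
        by (auto simp: vars_def)
      ultimately show ?l by (intro exI[of _ "fval e"] conjI ballI) simp_all
    qed
    finally show ?thesis using mem_R_iff[OF e(1)] sat_at_iff[OF distinct_ys fv, of M e]
      by (simp only: e(2))
  qed
  then have "defines_rel L M \<psi> ys R"
    unfolding defines_rel_def by (intro conjI ballI form fv)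
  then show ?thesis by (rule exI)
qed

lemma not_shatters_grid:
  assumes nip: "\<And>A q. is_formula L0 q \<Longrightarrow> \<exists>k. vc_bound L0 M0 A q k"
    and \<psi>: "defines_rel L M \<psi> ys R"
  shows "\<exists>n N. n > 0 \<and> N > 0 \<and> \<not> shatters_grid M K N n (y 1) (y 2) (y 3) \<psi>"
proof -
  \<comment> \<open>Variables in \<open>A\<close> receive values F(a, b), those in \<open>B\<close>
    values G(a, c), and the remaining ones among \<open>xs\<close> values H(b, c).\<close>
  define A where "A = {v. s (block v) = 1 \<and> t (block v) = 2}"
  define B where "B = {v. s (block v) = 1 \<and> t (block v) = 3}"
  have "\<exists>(n :: nat) (N :: nat). n > 0 \<and> N > 0 \<and> (\<forall>w. (\<forall>i j. w i j \<in> assignments L0 M0) \<longrightarrow>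
    (\<exists>S. \<forall>u v. (\<forall>i. u i \<in> assignments L0 M0) \<longrightarrow> (\<forall>j. v j \<in> assignments L0 M0) \<longrightarrow>
      (\<exists>i<N. \<exists>j<n.
        sat M0 (override_on (override_on (w i j) (v j) B) (u i) A) \<phi> \<noteq> ((i, j) \<in> S))))"
    by (rule grid_pattern_not_realized[OF struct(1) _ \<phi>(1)]) (rule nip)
  then obtain n N :: nat where nN: "n > 0" "N > 0" and grid: "\<forall>w. (\<forall>i j. w i j \<in> assignments L0 M0) \<longrightarrow>
    (\<exists>S. \<forall>u v. (\<forall>i. u i \<in> assignments L0 M0) \<longrightarrow> (\<forall>j. v j \<in> assignments L0 M0) \<longrightarrow>
      (\<exists>i<N. \<exists>j<n.
        sat M0 (override_on (override_on (w i j) (v j) B) (u i) A) \<phi> \<noteq> ((i, j) \<in> S)))"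
    by (elim exE conjE)
  have "\<not> shatters_grid M K N n (y 1) (y 2) (y 3) \<psi>"
  proof
    assume "shatters_grid M K N n (y 1) (y 2) (y 3) \<psi>"
    then obtain e1 where e1: "\<forall>i<N. \<forall>j<n. \<forall>v\<in>set (y 2 @ y 3).
        e1 (grid_copy K (y 2) (i, j) v) \<in> carrier M (var_sort v)"
      and sh: "\<forall>T \<subseteq> {..<N} \<times> {..<n}. \<exists>e2. (\<forall>v\<in>set (y 1). e2 v \<in> carrier M (var_sort v)) \<and>
          (\<forall>i<N. \<forall>j<n. sat M (cell K (y 1) (y 2) e1 e2 i j) \<psi> \<longleftrightarrow> (i, j) \<in> T)"
      unfolding shatters_grid_def by (elim exE conjE)
    obtain e0 where e0: "e0 \<in> assignments L M"
      using assignments_nonempty[OF struct(2)] by (rule exE)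
    obtain m0 where m0: "m0 \<in> assignments L0 M0"
      using assignments_nonempty[OF struct(1)] by (rule exE)
    \<comment> \<open>A well-sorted version of \<open>cell\<close>: the grid bound asks for
      assignments at all \<open>i\<close> and \<open>j\<close>, so \<open>e0\<close> fills in
      outside the grid and wherever \<open>e2\<close> is ill-sorted.\<close>
    define E where "E e2 i j v = (if v \<in> set ys \<and> i < N \<and> j < n \<and> (v \<in> set (y 1) \<longrightarrow>
        e2 v \<in> carrier M (var_sort v)) then cell K (y 1) (y 2) e1 e2 i j v else e0 v)" for e2 i j v
    have E: "E e2 i j \<in> assignments L M" for e2 i j
    proof -
      have "E e2 i j v \<in> carrier M (var_sort v)" if "v \<in> vars L" for v
      proof -
        have "e0 v \<in> carrier M (var_sort v)" using e0 that by (simp add: assignments_def)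
        then show ?thesis using e1 by (simp add: E_def cell_def)
      qed
      then show ?thesis by (simp add: assignments_def)
    qed
    \<comment> \<open>Passes from an \<open>L\<close>-assignment of the \<open>y j\<close> to an
      \<open>L0\<close>-assignment of the \<open>x i\<close>.\<close>
    define G where "G e v = (if v \<in> set xs then fval e v else m0 v)" for e v
    have G: "G (E e2 i j) \<in> assignments L0 M0" for e2 i j
      using m0 fval_in_carrier[OF E] by (simp add: G_def assignments_def)
    \<comment> \<open>The array \<open>w\<close> must be fixed before \<open>S\<close> and hence
      before \<open>e2\<close>. Putting \<open>e0\<close> in the place of \<open>e2\<close> is
      harmless, because H(b, c) does not involve \<open>y 1\<close>.\<close>
    have "\<forall>i j. G (E e0 i j) \<in> assignments L0 M0" using G by simp
    from grid[THEN spec, THEN mp, OF this]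
    obtain S where S: "\<forall>u v. (\<forall>i. u i \<in> assignments L0 M0) \<longrightarrow>
        (\<forall>j. v j \<in> assignments L0 M0) \<longrightarrow> (\<exists>i<N. \<exists>j<n.
        sat M0 (override_on (override_on (G (E e0 i j)) (v j) B) (u i) A) \<phi> \<noteq> ((i, j) \<in> S))"
      by (rule exE)
    have "S \<inter> ({..<N} \<times> {..<n}) \<subseteq> {..<N} \<times> {..<n}" by blast
    from sh[THEN spec, THEN mp, OF this]
    obtain e2 where e2: "\<forall>v\<in>set (y 1). e2 v \<in> carrier M (var_sort v)"
      and sat_cell: "\<forall>i<N. \<forall>j<n. sat M (cell K (y 1) (y 2) e1 e2 i j) \<psi> \<longleftrightarrow>
        (i, j) \<in> S \<inter> ({..<N} \<times> {..<n})"
      by (elim exE conjE)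
    \<comment> \<open>Values F(a, b) are the same in every column and values G(a, c) in every row;
      column 0 and row 0 represent them.\<close>
    have "\<exists>i<N. \<exists>j<n. sat M0 (override_on (override_on (G (E e0 i j)) (G (E e2 0 j)) B)
        (G (E e2 i 0)) A) \<phi> \<noteq> ((i, j) \<in> S)"
      using S[THEN spec, THEN spec, THEN mp, THEN mp, of "\<lambda>i. G (E e2 i 0)" "\<lambda>j. G (E e2 0 j)"] G
      by simp
    then obtain i j where ij: "i < N" "j < n" and neq: "sat M0 (override_on (override_on
        (G (E e0 i j)) (G (E e2 0 j)) B) (G (E e2 i 0)) A) \<phi> \<noteq> ((i, j) \<in> S)"
      by (elim exE conjE)
    have E_y: "E e2 i j v = E e2 i 0 v" if "v \<in> set (y 1) \<union> set (y 2)" for v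
      using that ij nN dist by (auto simp: E_def cell_def grid_copy_def)
    have E_y': "E e2 i j v = E e2 0 j v" if "v \<in> set (y 1) \<union> set (y 3)" for v
      using that ij nN dist by (auto simp: E_def cell_def grid_copy_def)
    have E_y'': "E e2 i j v = E e0 i j v" if "v \<in> set (y 2) \<union> set (y 3)" for v
      using that ij nN dist by (auto simp: E_def cell_def grid_copy_def)
    have mix: "override_on (override_on (G (E e0 i j)) (G (E e2 0 j)) B) (G (E e2 i 0)) A v =
        G (E e2 i j) v" if v: "v \<in> set xs" for v
    proof -
      obtain k where k: "k \<in> {1..d}" "v \<in> set (x k)" using v unfolding set_xs by (rule UN_E)
      then have "block v = k" by (rule block_eq)
      then have "s (block v) \<in> {1, 2, 3} \<and> t (block v) \<in> {1, 2, 3} \<and> s (block v) < t (block v)"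
        using st[OF k(1)] by simp
      then consider "s (block v) = 1" "t (block v) = 2" | "s (block v) = 1" "t (block v) = 3"
        | "s (block v) = 2" "t (block v) = 3"
        by force
      then show ?thesis
      proof cases
        case 1
        then have "fval (E e2 i j) v = fval (E e2 i 0) v"
          using E_y by (intro fval_cong[OF v]) simp
        then show ?thesis using 1 v by (simp add: A_def G_def override_on_def)
      next
        case 2
        then have "fval (E e2 i j) v = fval (E e2 0 j) v"
          using E_y' by (intro fval_cong[OF v]) simp
        then show ?thesis using 2 v by (simp add: A_def B_def G_def override_on_def)
      next
        case 3
        then have "fval (E e2 i j) v = fval (E e0 i j) v"
          using E_y'' by (intro fval_cong[OF v]) simp
        then show ?thesis using 3 v by (simp add: A_def B_def G_def override_on_def)
      qed
    qed
    have "sat M0 (override_on (override_on (G (E e0 i j)) (G (E e2 0 j)) B) (G (E e2 i 0)) A) \<phi>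
        \<longleftrightarrow> sat M0 (G (E e2 i j)) \<phi>"
      using mix \<phi>(2) by (intro sat_cong) blast
    also have "\<dots> \<longleftrightarrow> sat M (G (E e2 i j)) \<phi>"
      using expansion_sat[OF expansion G \<phi>(1)] by simp
    also have "\<dots> \<longleftrightarrow> sat M (fval (E e2 i j)) \<phi>"
      using \<phi>(2) by (intro sat_cong) (auto simp: G_def)
    also have "\<dots> \<longleftrightarrow> sat M (E e2 i j) \<psi>" using defines_R_iff[OF \<psi> E] by simp
    also have "\<dots> \<longleftrightarrow> sat M (cell K (y 1) (y 2) e1 e2 i j) \<psi>"
    proof (rule sat_cong)
      fix v assume "v \<in> fv \<psi>"
      then have "v \<in> set ys" using \<psi> unfolding defines_rel_def by blast
      then show "E e2 i j v = cell K (y 1) (y 2) e1 e2 i j v"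
        using ij e2 by (simp add: E_def)
    qed
    also have "\<dots> \<longleftrightarrow> (i, j) \<in> S" using sat_cell ij by simp
    finally show False using neq by simp
  qed
  then show ?thesis using nN by blast
qed

end

theorem theorem5p12:
  fixes L0 L :: "('f, 'r, 's) language"
    and M0 M :: "('f, 'r, 's, 'a) struct"
    and \<phi> :: "('f, 'r, 's) fm"
    and d :: nat
    and x y :: "nat \<Rightarrow> 's var list"
    and s t :: "nat \<Rightarrow> nat"
    and f :: "nat \<Rightarrow> 'a list \<Rightarrow> 'a list \<Rightarrow> 'a list"
  assumes "is_language L0" and "is_language L"
    and "is_struct L0 M0"
    and "dependent_structure TYPE(nat \<Rightarrow> 'a) L0 M0"
    and "expansion L0 M0 L M"
    and "is_formula L0 \<phi>"
    and "fv \<phi> \<subseteq> set (concat (map x [1..<Suc d]))"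
    and "\<And>i. i \<in> {1..d} \<Longrightarrow> set (x i) \<subseteq> vars L0"
    and "\<And>j. j \<in> {1, 2, 3} \<Longrightarrow> set (y j) \<subseteq> vars L"
    and "distinct (concat (map x [1..<Suc d]) @ y 1 @ y 2 @ y 3)"
    and "\<And>i. i \<in> {1..d} \<Longrightarrow> s i \<in> {1, 2, 3} \<and> t i \<in> {1, 2, 3} \<and> s i < t i"
    and "\<And>i. i \<in> {1..d} \<Longrightarrow> definable_fun2 L M (y (s i)) (y (t i)) (x i) (f i)"
  shows "(\<exists>\<psi>. defines_rel L M \<psi> (y 1 @ y 2 @ y 3) (composite_relation M d \<phi> x y s t f)) \<and>
         (\<forall>\<psi>. defines_rel L M \<psi> (y 1 @ y 2 @ y 3) (composite_relation M d \<phi> x y s t f) \<longrightarrow>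
              n_dependent_formula TYPE('u) 2 L (Th L M) \<psi> (y 1) [y 2, y 3])"
proof (intro conjI allI impI)
  interpret binary_composition L0 L M0 M \<phi> d x y s t f
    by (rule binary_composition.intro; fact assms)
  show "\<exists>\<psi>. defines_rel L M \<psi> ys R" by (rule ex_defining_formula)
  fix \<psi> assume \<psi>: "defines_rel L M \<psi> ys R"
  have form: "is_formula L \<psi>" using \<psi> unfolding defines_rel_def by (elim conjE)
  have fv: "fv \<psi> \<subseteq> set ys" using \<psi> unfolding defines_rel_def by (elim conjE)
  obtain K where K: "\<forall>j v. copy K j v \<notin> set ys"
    using ex_fresh_copy[OF finite_set[of ys]] by (rule exE)
  have "\<exists>n N. n > 0 \<and> N > 0 \<and> \<not> shatters_grid M K N n (y 1) (y 2) (y 3) \<psi>"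
    by (rule not_shatters_grid[OF _ \<psi>]) (rule dependent_structure_vc_bound[OF assms(3,4)])
  then obtain n N
    where nN: "n > 0" "N > 0" and not_sh: "\<not> shatters_grid M K N n (y 1) (y 2) (y 3) \<psi>"
    by (elim exE conjE)
  have "\<not> has_independence_property TYPE('u) L (Th L M) \<psi> (y 1) [y 2, y 3]"
  proof
    assume "has_independence_property TYPE('u) L (Th L M) \<psi> (y 1) [y 2, y 3]"
    then obtain Q :: "('f, 'r, 's, 'u) struct"
      where Q: "is_model L (Th L M) Q" "shatters_in Q \<psi> (y 1) [y 2, y 3]"
      unfolding has_independence_property_def by (elim exE conjE)
    \<comment> \<open>From here the grid sentence leads from a model on the type \<open>'u\<close>
      back to \<open>M\<close>, where this grid is not shattered.\<close>
    have "shatters_grid Q K N n (y 1) (y 2) (y 3) \<psi>"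
      by (rule shatters_in_shatters_grid[OF Q(2) fv distinct_ys])
    then have "sat Q e (grid_fm K N n (y 1) (y 2) (y 3) \<psi>)" for e
      using sat_grid_fm[OF nN fv distinct_ys K[rule_format], of Q e] by (simp only:)
    then have "sat M undefined (grid_fm K N n (y 1) (y 2) (y 3) \<psi>)"
      by (rule Th_complete[OF Q(1) grid_fm_sentence[OF nN form fv ys_vars]])
    then have "shatters_grid M K N n (y 1) (y 2) (y 3) \<psi>"
      using sat_grid_fm[OF nN fv distinct_ys K[rule_format], of M undefined] by (simp only:)
    with not_sh show False ..
  qed
  moreover have "partitioned_formula L \<psi> (y 1) [y 2, y 3]"
    using form fv distinct_ys ys_vars by (simp add: partitioned_formula_def)
  ultimately show "n_dependent_formula TYPE('u) 2 L (Th L M) \<psi> (y 1) [y 2, y 3]"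
    by (simp add: n_dependent_formula_def)
qed

end
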